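(* Let $K$ be a field of characteristic $p>0$, $k=\bigcap_{n\ge0}K^{p^n}$, with $K/k$ finitely generated, and let $W$ be a subfield with $k\subset W\subset K$. Consider the restriction map $d(K/W):\operatorname{Diff}_k(K)\to\operatorname{Hom}_k(W,K)$, $D\mapsto D|_W$. Then: (a) the image of $d(K/W)$ equals the image of the (injective) natural map $\operatorname{Diff}_k(W)\otimes_WK\to\operatorname{Hom}_k(W,K)$, $D'\otimes a\mapsto a\cdot D'$; i.e. $d(K/W):\operatorname{Diff}_k(K)\to\operatorname{Diff}_k(W)\otimes_WK$ is surjective; (b) the kernel of $d(K/W)$ equals the $K$-span $\operatorname{Diff}_k(K)\circ\mathfrak E(K/W)$ of all composites $D_1\circ D_2$ with $D_1\in\operatorname{Diff}_k(K)$ and $D_2\in\mathfrak E(K/W):=\{D\in\operatorname{Diff}_W(K): D(1)=0\}$. Thus there is a short exact sequence of $K$-vector spaces $0\to\operatorname{Diff}_k(K)\circ\mathfrak E(K/W)\to\operatorname{Diff}_k(K)\to\operatorname{Diff}_k(W)\otimes_WK\to0$.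
   Context: $K^{p^n}=\{x^{p^n}:x\in K\}$. For a subring $L\subset R$, $\operatorname{Diff}_L(R)$ is the ring of Grothendieck differential operators: $F_{-1}=0$, $F_d=\{D\in\operatorname{End}_L(R):[D,f]\in F_{d-1}\ \forall f\in R\}$ ($f$ = multiplication by $f$), $\operatorname{Diff}_L(R)=\bigcup_dF_d$. *)

theory Defs
  imports Main
begin

definition is_subfield :: "'a::field set \<Rightarrow> bool" where
  "is_subfield F \<longleftrightarrow> 0 \<in> F \<and> 1 \<in> F \<and>
     (\<forall>x\<in>F. \<forall>y\<in>F. x + y \<in> F \<and> x * y \<in> F) \<and>
     (\<forall>x\<in>F. - x \<in> F \<and> inverse x \<in> F)"

definition gen_field :: "'a::field set \<Rightarrow> 'a set" where
  "gen_field S = \<Inter>{F. is_subfield F \<and> S \<subseteq> F}"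

definition fin_gen_over :: "'a::field set \<Rightarrow> bool" where
  "fin_gen_over k \<longleftrightarrow> (\<exists>S. finite S \<and> gen_field (k \<union> S) = UNIV)"

definition perfect_core :: "nat \<Rightarrow> 'a::field set" where
  "perfect_core p = (\<Inter>n. {x ^ (p ^ n) | x. True})"

text \<open>End_L(R): L-linear endomorphisms of R (only the values on R matter).\<close>
definition is_End :: "'a::field set \<Rightarrow> 'a set \<Rightarrow> ('a \<Rightarrow> 'a) \<Rightarrow> bool" where
  "is_End L R D \<longleftrightarrow> (\<forall>x\<in>R. D x \<in> R) \<and>
     (\<forall>x\<in>R. \<forall>y\<in>R. D (x + y) = D x + D y) \<and>
     (\<forall>l\<in>L. \<forall>x\<in>R. D (l * x) = l * D x)"

text \<open>Grothendieck filtration: diff_filt L R n D means D \<in> F_(n-1);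
  diff_filt L R 0 is F_(-1) = 0.\<close>
fun diff_filt :: "'a::field set \<Rightarrow> 'a set \<Rightarrow> nat \<Rightarrow> ('a \<Rightarrow> 'a) \<Rightarrow> bool" where
  "diff_filt L R 0 D \<longleftrightarrow> (\<forall>x\<in>R. D x = 0)"
| "diff_filt L R (Suc n) D \<longleftrightarrow> is_End L R D \<and>
     (\<forall>f\<in>R. diff_filt L R n (\<lambda>x. D (f * x) - f * D x))"

definition is_Diff :: "'a::field set \<Rightarrow> 'a set \<Rightarrow> ('a \<Rightarrow> 'a) \<Rightarrow> bool" where
  "is_Diff L R D \<longleftrightarrow> (\<exists>n. diff_filt L R n D)"

definition is_E :: "'a::field set \<Rightarrow> ('a \<Rightarrow> 'a) \<Rightarrow> bool" where
  "is_E W D \<longleftrightarrow> is_Diff W UNIV D \<and> D 1 = 0"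

end

theory Submission
  imports Defs "HOL-Computational_Algebra.Computational_Algebra"
begin

text \<open>
  Write \<open>W_n\<close> for the image of \<open>W\<close> under the \<open>n\<close>-th power of Frobenius. Since \<open>ad f ^ q = ad (f ^ q)\<close>
  for a power \<open>q\<close> of \<open>p\<close>, every differential operator on \<open>W\<close> is \<open>W_n\<close>-linear for some \<open>n\<close>, and the
  converse holds because \<open>W\<close> is finite over \<open>W_n\<close>. All claims become linear algebra over the \<open>W_n\<close>.

  If \<open>D\<close> is \<open>K_m\<close>-linear and kills \<open>W\<close>, it kills the field \<open>F = K_m W\<close>, so \<open>D = D \<circ> (id - \<pi>)\<close> for an
  \<open>F\<close>-linear projection \<open>\<pi>\<close> of \<open>K\<close> onto \<open>F\<close>; this is (b). The hard part of (a) is that a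
  \<open>W_n\<close>-linear map \<open>W \<rightarrow> K\<close> extends to a \<open>K_m\<close>-linear map \<open>K \<rightarrow> K\<close> for some \<open>m\<close>. One adjoins the
  generators of \<open>K\<close> one at a time: for \<open>V = W(x)\<close> with \<open>x\<close> transcendental, or separable algebraic, over
  \<open>W\<close>, the fields \<open>W\<close> and \<open>V_n\<close> are linearly disjoint over \<open>W_n\<close>, and one takes \<open>m = n\<close>; if
  \<open>x ^ p \<in> W\<close>, then \<open>V_(n+1) \<subseteq> W_n\<close> and \<open>m = n + 1\<close> works.
\<close>

section \<open>Linear algebra over a subfield\<close>

lemma subfieldD:
  assumes "is_subfield F"
  shows subfield_0: "0 \<in> F" and subfield_1: "1 \<in> F"
    and subfield_add: "\<And>x y. x \<in> F \<Longrightarrow> y \<in> F \<Longrightarrow> x + y \<in> F"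
    and subfield_mult: "\<And>x y. x \<in> F \<Longrightarrow> y \<in> F \<Longrightarrow> x * y \<in> F"
    and subfield_minus: "\<And>x. x \<in> F \<Longrightarrow> - x \<in> F"
    and subfield_inverse: "\<And>x. x \<in> F \<Longrightarrow> inverse x \<in> F"
  using assms by (auto simp: is_subfield_def)

lemma subfield_diff: "is_subfield F \<Longrightarrow> x \<in> F \<Longrightarrow> y \<in> F \<Longrightarrow> x - y \<in> F"
  by (metis diff_conv_add_uminus subfield_add subfield_minus)

lemma subfield_power: "is_subfield F \<Longrightarrow> x \<in> F \<Longrightarrow> x ^ n \<in> F"
  by (induction n) (auto intro: subfield_1 subfield_mult)

lemma subfield_UNIV: "is_subfield UNIV"
  by (simp add: is_subfield_def)

lemma subfield_gen_field: "is_subfield (gen_field S)"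
  unfolding gen_field_def is_subfield_def by blast

lemma gen_field_superset: "S \<subseteq> gen_field S"
  unfolding gen_field_def by blast

lemma gen_field_least: "is_subfield F \<Longrightarrow> S \<subseteq> F \<Longrightarrow> gen_field S \<subseteq> F"
  unfolding gen_field_def by blast

section \<open>Subspaces, linear maps and spans inside one ambient field\<close>

definition subsp :: "'a::field set \<Rightarrow> 'a set \<Rightarrow> bool" where
  "subsp F S \<longleftrightarrow> 0 \<in> S \<and> (\<forall>x\<in>S. \<forall>y\<in>S. x + y \<in> S) \<and> (\<forall>c\<in>F. \<forall>x\<in>S. c * x \<in> S)"

definition lin_on :: "'a::field set \<Rightarrow> 'a set \<Rightarrow> ('a \<Rightarrow> 'a) \<Rightarrow> bool" where
  "lin_on F S g \<longleftrightarrow> (\<forall>x\<in>S. \<forall>y\<in>S. g (x + y) = g x + g y) \<and> (\<forall>c\<in>F. \<forall>x\<in>S. g (c * x) = c * g x)"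

text \<open>Generated one term at a time, so that rule induction only ever adds a single
  \<open>c * b\<close>; members of \<open>B\<close> may recur, and no independence is built
  in.\<close>

inductive_set fspan :: "'a::field set \<Rightarrow> 'a set \<Rightarrow> 'a set" for F B where
  zero: "0 \<in> fspan F B"
| step: "c \<in> F \<Longrightarrow> b \<in> B \<Longrightarrow> x \<in> fspan F B \<Longrightarrow> c * b + x \<in> fspan F B"

definition fin_over :: "'a::field set \<Rightarrow> 'a set \<Rightarrow> bool" where
  "fin_over F V \<longleftrightarrow> (\<exists>B. finite B \<and> B \<subseteq> V \<and> V \<subseteq> fspan F B)"

lemma subspD:
  assumes "subsp F S"
  shows subsp_0: "0 \<in> S"
    and subsp_add: "\<And>x y. x \<in> S \<Longrightarrow> y \<in> S \<Longrightarrow> x + y \<in> S"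
    and subsp_smult: "\<And>c x. c \<in> F \<Longrightarrow> x \<in> S \<Longrightarrow> c * x \<in> S"
  using assms by (auto simp: subsp_def)

lemma lin_onD:
  assumes "lin_on F S g"
  shows lin_on_add: "\<And>x y. x \<in> S \<Longrightarrow> y \<in> S \<Longrightarrow> g (x + y) = g x + g y"
    and lin_on_smult: "\<And>c x. c \<in> F \<Longrightarrow> x \<in> S \<Longrightarrow> g (c * x) = c * g x"
  using assms by (auto simp: lin_on_def)

lemma lin_on_0: "lin_on F S g \<Longrightarrow> 0 \<in> S \<Longrightarrow> g 0 = 0"
  by (metis add.right_neutral add_cancel_right_right lin_on_add)

lemma lin_on_sum:
  assumes "lin_on F S g" "subsp F S" "\<And>i. i \<in> I \<Longrightarrow> f i \<in> S"
  shows "sum f I \<in> S \<and> g (sum f I) = (\<Sum>i\<in>I. g (f i))"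
  using assms(3)
  by (induction I rule: infinite_finite_induct)
    (auto simp: subsp_0[OF assms(2)] subsp_add[OF assms(2)] lin_on_add[OF assms(1)]
       lin_on_0[OF assms(1)])

lemma lin_on_subset: "lin_on F S g \<Longrightarrow> F' \<subseteq> F \<Longrightarrow> S' \<subseteq> S \<Longrightarrow> lin_on F' S' g"
  unfolding lin_on_def by blast

lemma subsp_subset: "subsp F S \<Longrightarrow> F' \<subseteq> F \<Longrightarrow> subsp F' S"
  unfolding subsp_def by blast

lemma subsp_subfield: "is_subfield W \<Longrightarrow> F \<subseteq> W \<Longrightarrow> subsp F W"
  unfolding subsp_def is_subfield_def by blast

lemma subsp_sum:
  assumes "subsp F S" "\<And>i. i \<in> I \<Longrightarrow> f i \<in> S" shows "sum f I \<in> S"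
  using assms(2) by (induction I rule: infinite_finite_induct)
    (auto simp: subsp_0[OF assms(1)] subsp_add[OF assms(1)])

lemma fspan_add: "x \<in> fspan F B \<Longrightarrow> y \<in> fspan F B \<Longrightarrow> x + y \<in> fspan F B"
  by (induction rule: fspan.induct) (auto simp: add.assoc intro: fspan.step)

lemma subsp_fspan:
  assumes "is_subfield F"
  shows "subsp F (fspan F B)"
proof -
  have "c * x \<in> fspan F B" if "c \<in> F" "x \<in> fspan F B" for c x
    using that(2) by (induction rule: fspan.induct)
      (auto simp: distrib_left mult.assoc[symmetric] intro!: fspan.intros subfield_mult[OF assms] that(1))
  thus ?thesis by (auto simp: subsp_def fspan_add fspan.zero)
qed

lemma fspan_superset: "is_subfield F \<Longrightarrow> B \<subseteq> fspan F B"
  using fspan.step[OF subfield_1 _ fspan.zero] by fastforce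

lemma fspan_least: "subsp F S \<Longrightarrow> B \<subseteq> S \<Longrightarrow> fspan F B \<subseteq> S"
proof
  fix x assume S: "subsp F S" "B \<subseteq> S" and "x \<in> fspan F B"
  from this(3) show "x \<in> S"
    by (induction rule: fspan.induct) (use S in \<open>auto simp: subsp_def\<close>)
qed

text \<open>Tower law in spanning-set form: the products of members of the two spanning sets
  span.\<close>

lemma fin_over_trans:
  assumes F: "is_subfield F" and G: "is_subfield G" and V: "is_subfield V"
    and FV: "F \<subseteq> V" and GF: "G \<subseteq> F" and 1: "fin_over F V" and 2: "fin_over G F"
  shows "fin_over G V"
proof -
  obtain B where B: "finite B" "B \<subseteq> V" "V \<subseteq> fspan F B" using 1 by (auto simp: fin_over_def)
  obtain C where C: "finite C" "C \<subseteq> F" "F \<subseteq> fspan G C" using 2 by (auto simp: fin_over_def)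
  define BC where "BC = (\<lambda>(c, b). c * b) ` (C \<times> B)"
  note S = subsp_fspan[OF G, of BC]
  have cb: "c * b \<in> fspan G BC" if "c \<in> F" "b \<in> B" for c b
  proof -
    have "c \<in> fspan G C" using C that by auto
    then show ?thesis
    proof (induction rule: fspan.induct)
      case zero thus ?case by (simp add: fspan.zero)
    next
      case (step u c x)
      have "c * b \<in> BC" using step that by (auto simp: BC_def)
      hence "u * (c * b) + x * b \<in> fspan G BC" using step by (intro fspan.step) auto
      thus ?case by (simp add: algebra_simps)
    qed
  qed
  have "x \<in> fspan G BC" if "x \<in> fspan F B" for x
    using that by (induction rule: fspan.induct) (auto intro: fspan.zero fspan_add cb)
  moreover have "BC \<subseteq> V" using B C FV by (auto simp: BC_def intro!: subfield_mult[OF V])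
  moreover have "finite BC" using B C by (simp add: BC_def)
  ultimately show ?thesis using B unfolding fin_over_def by blast
qed

section \<open>Extension of linear maps from subspaces, functionals and decompositions\<close>

lemma lin_on_extend1:
  assumes F: "is_subfield F" and S: "subsp F S" and g: "lin_on F S g" and b: "b \<notin> S"
  obtains S' g' where "subsp F S'" "S \<subseteq> S'" "b \<in> S'" "lin_on F S' g'" "\<forall>x\<in>S. g' x = g x"
    "g' b = t" "\<forall>x\<in>S'. \<exists>c\<in>F. \<exists>y\<in>S. g' x = c * t + g y"
proof -
  \<comment> \<open>Distinct coefficients could be divided out, which would place \<open>b\<close>
    in \<open>S\<close>. So representations are unique and \<open>b\<close> may be sent to any
    \<open>t\<close>.\<close>
  have uniq: "c = c' \<and> y = y'" if "c * b + y = c' * b + y'" "c \<in> F" "c' \<in> F" "y \<in> S" "y' \<in> S" for c c' y y'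
  proof -
    have "c = c'"
    proof (rule ccontr)
      assume ne: "c \<noteq> c'"
      have "(c - c') * b = y' + (-1) * y" using that by (simp add: algebra_simps)
      hence "b = inverse (c - c') * (y' + (-1) * y)" using ne by (simp add: field_simps)
      moreover have "inverse (c - c') \<in> F" using that F by (simp add: subfield_inverse subfield_diff)
      moreover have "y' + (-1) * y \<in> S" using S F that
        by (intro subsp_add[OF S] subsp_smult[OF S]) (auto intro: subfield_minus subfield_1)
      ultimately have "b \<in> S" using subsp_smult[OF S] by metis
      thus False using b by simp
    qed
    thus ?thesis using that by simp
  qed
  define S' where "S' = {c * b + y | c y. c \<in> F \<and> y \<in> S}"
  define P where "P x z \<longleftrightarrow> (\<exists>c\<in>F. \<exists>y\<in>S. x = c * b + y \<and> z = c * t + g y)" for x z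
  define g' where "g' x = (THE z. P x z)" for x
  have g': "g' (c * b + y) = c * t + g y" if "c \<in> F" "y \<in> S" for c y
    unfolding g'_def P_def by (rule the_equality) (use that uniq in blast)+
  have "subsp F S'" unfolding subsp_def
  proof (intro conjI ballI)
    show "0 \<in> S'" unfolding S'_def using subfield_0[OF F] subsp_0[OF S] by force
    fix x assume x: "x \<in> S'"
    then obtain c y where 1: "c \<in> F" "y \<in> S" "x = c * b + y" by (auto simp: S'_def)
    { fix x' assume "x' \<in> S'"
      then obtain c' y' where 2: "c' \<in> F" "y' \<in> S" "x' = c' * b + y'" by (auto simp: S'_def)
      have "x + x' = (c + c') * b + (y + y')" using 1 2 by (simp add: algebra_simps)
      moreover have "c + c' \<in> F" "y + y' \<in> S" using 1 2 subfield_add[OF F] subsp_add[OF S] by auto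
      ultimately show "x + x' \<in> S'" unfolding S'_def by blast }
    { fix a assume a: "a \<in> F"
      have "a * x = (a * c) * b + a * y" using 1 by (simp add: algebra_simps)
      moreover have "a * c \<in> F" "a * y \<in> S" using 1 a subfield_mult[OF F] subsp_smult[OF S] by auto
      ultimately show "a * x \<in> S'" unfolding S'_def by blast }
  qed
  moreover have "lin_on F S' g'" unfolding lin_on_def
  proof (intro conjI ballI)
    fix x assume x: "x \<in> S'"
    then obtain c y where 1: "c \<in> F" "y \<in> S" "x = c * b + y" by (auto simp: S'_def)
    { fix x' assume "x' \<in> S'"
      then obtain c' y' where 2: "c' \<in> F" "y' \<in> S" "x' = c' * b + y'" by (auto simp: S'_def)
      have "x + x' = (c + c') * b + (y + y')" using 1 2 by (simp add: algebra_simps)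
      moreover have "g' ((c + c') * b + (y + y')) = (c + c') * t + g (y + y')"
        using 1 2 by (intro g') (auto intro: subfield_add[OF F] subsp_add[OF S])
      moreover have "g' x = c * t + g y" "g' x' = c' * t + g y'" using 1 2 g' by auto
      moreover have "g (y + y') = g y + g y'" using 1 2 by (simp add: lin_on_add[OF g])
      ultimately show "g' (x + x') = g' x + g' x'" by (simp add: distrib_right) }
    { fix a assume a: "a \<in> F"
      have "a * x = (a * c) * b + a * y" using 1 by (simp add: algebra_simps)
      moreover have "g' ((a * c) * b + a * y) = (a * c) * t + g (a * y)"
        using 1 a by (intro g') (auto intro: subfield_mult[OF F] subsp_smult[OF S])
      moreover have "g' x = c * t + g y" using 1 g' by auto
      moreover have "g (a * y) = a * g y" using 1 a by (simp add: lin_on_smult[OF g])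
      ultimately show "g' (a * x) = a * g' x" by (simp add: distrib_left mult.assoc) }
  qed
  moreover have "g' x = g x" if "x \<in> S" for x
    using g'[OF subfield_0[OF F] that] by simp
  moreover have "g' b = t"
    using g'[OF subfield_1[OF F] subsp_0[OF S]] lin_on_0[OF g subsp_0[OF S]] by simp
  moreover have "S \<subseteq> S'" unfolding S'_def using subfield_0[OF F] by force
  moreover have "b \<in> S'" unfolding S'_def using subfield_1[OF F] subsp_0[OF S] by force
  moreover have "\<exists>c\<in>F. \<exists>y\<in>S. g' x = c * t + g y" if "x \<in> S'" for x
    using that g' by (auto simp: S'_def)
  ultimately show ?thesis using that by metis
qed

text \<open>Vectors of \<open>B\<close> outside the current domain are sent to \<open>0\<close>, so
  no new values arise and the range stays inside \<open>T\<close>.\<close>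

lemma lin_on_extend:
  assumes F: "is_subfield F" and B: "finite B" and S: "subsp F S" and g: "lin_on F S g"
    and T: "g ` S \<subseteq> T"
  obtains S' g' where "subsp F S'" "S \<subseteq> S'" "fspan F B \<subseteq> S'" "lin_on F S' g'"
    "\<forall>x\<in>S. g' x = g x" "g' ` S' \<subseteq> T"
proof -
  have "\<exists>S' g'. subsp F S' \<and> S \<subseteq> S' \<and> B \<subseteq> S' \<and> lin_on F S' g' \<and> (\<forall>x\<in>S. g' x = g x) \<and> g' ` S' \<subseteq> T"
    using B
  proof (induction B rule: finite_induct)
    case empty thus ?case using S g T by blast
  next
    case (insert b B)
    then obtain S1 g1 where 1: "subsp F S1" "S \<subseteq> S1" "B \<subseteq> S1" "lin_on F S1 g1" "\<forall>x\<in>S. g1 x = g x"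
      "g1 ` S1 \<subseteq> T" by blast
    show ?case
    proof (cases "b \<in> S1")
      case True thus ?thesis using 1 by blast
    next
      case False
      obtain S2 g2 where 2: "subsp F S2" "S1 \<subseteq> S2" "b \<in> S2" "lin_on F S2 g2" "\<forall>x\<in>S1. g2 x = g1 x"
        "g2 b = 0" "\<forall>x\<in>S2. \<exists>c\<in>F. \<exists>y\<in>S1. g2 x = c * 0 + g1 y"
        by (rule lin_on_extend1[OF F 1(1) 1(4) False, of 0])
      have "g2 ` S2 \<subseteq> T" using 2(7) 1(6) by fastforce
      moreover have "\<forall>x\<in>S. g2 x = g x" using 1 2 by auto
      ultimately show ?thesis using 1 2 by (intro exI[of _ S2] exI[of _ g2]) auto
    qed
  qed
  then obtain S' g' where "subsp F S'" "S \<subseteq> S'" "B \<subseteq> S'" "lin_on F S' g'" "\<forall>x\<in>S. g' x = g x" "g' ` S' \<subseteq> T"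
    by blast
  thus ?thesis using that[of S' g'] fspan_least by blast
qed

text \<open>Control of the range yields both projections (extend the identity of a subfield) and
  functionals (take \<open>T = F\<close>) from one statement.\<close>

lemma lin_on_extend_fin:
  assumes F: "is_subfield F" and V: "fin_over F V" and S: "subsp F S" and g: "lin_on F S g"
    and T: "g ` S \<subseteq> T"
  obtains g' where "lin_on F V g'" "\<forall>x\<in>S. g' x = g x" "g' ` V \<subseteq> T"
proof -
  obtain B where B: "finite B" "V \<subseteq> fspan F B" using V by (auto simp: fin_over_def)
  obtain S' g' where *: "subsp F S'" "S \<subseteq> S'" "fspan F B \<subseteq> S'" "lin_on F S' g'"
    "\<forall>x\<in>S. g' x = g x" "g' ` S' \<subseteq> T"
    by (rule lin_on_extend[OF F B(1) S g T])
  show ?thesis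
  proof (rule that[of g'])
    show "lin_on F V g'" using lin_on_subset[OF *(4) order.refl order.trans[OF B(2) *(3)]] .
    show "g' ` V \<subseteq> T" using * B by blast
  qed (use * in auto)
qed

lemma lin_on_functional:
  assumes F: "is_subfield F" and V: "fin_over F V" and S: "subsp F S" and b: "b \<notin> S"
  obtains g where "lin_on F V g" "\<forall>x\<in>S. g x = 0" "g b = 1" "g ` V \<subseteq> F"
proof -
  have "lin_on F S (\<lambda>_. 0)" by (simp add: lin_on_def)
  then obtain S1 g1 where 1: "subsp F S1" "S \<subseteq> S1" "b \<in> S1"
    "lin_on F S1 g1" "\<forall>x\<in>S. g1 x = 0" "g1 b = 1"
    "\<forall>x\<in>S1. \<exists>c\<in>F. \<exists>y\<in>S. g1 x = c * 1 + 0"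
    by (rule lin_on_extend1[OF F S _ b, of "\<lambda>_. 0" 1])
  have "g1 ` S1 \<subseteq> F" using 1(7) by auto
  then obtain g where g: "lin_on F V g" "\<forall>x\<in>S1. g x = g1 x" "g ` V \<subseteq> F"
    by (rule lin_on_extend_fin[OF F V 1(1,4)])
  show ?thesis by (rule that[of g]) (use g 1 in auto)
qed

text \<open>This is the finite-dimensional identity
  \<open>Hom_F(W, K) = K \<otimes> Hom_F(W, F)\<close>. The \<open>E i\<close> are
  \<open>F\<close>-valued so that they map \<open>W\<close> into itself and can serve as operators
  on \<open>W\<close>.\<close>

lemma lin_on_decomp:
  assumes F: "is_subfield F" and W: "is_subfield W" and FW: "F \<subseteq> W" and fin: "fin_over F W"
    and D: "lin_on F W D"
  obtains n :: nat and a E where "\<forall>i<n. lin_on F W (E i) \<and> E i ` W \<subseteq> F"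
    "\<forall>x\<in>W. D x = (\<Sum>i<n. a i * E i x)"
proof -
  obtain B where B: "finite B" "B \<subseteq> W" "W \<subseteq> fspan F B" using fin by (auto simp: fin_over_def)
  have "\<exists>(n::nat) a E. (\<forall>i<n. lin_on F W (E i) \<and> E i ` W \<subseteq> F) \<and> (\<forall>x\<in>fspan F B. D x = (\<Sum>i<n. a i * E i x))"
    using B(1,2)
  proof (induction B rule: finite_induct)
    case empty
    have "x = 0" if "x \<in> fspan F {}" for x using that by (cases rule: fspan.cases) auto
    thus ?case using lin_on_0[OF D subfield_0[OF W]] by (intro exI[of _ 0]) auto
  next
    case (insert b B)
    then obtain n :: nat and a E where
      E: "\<forall>i<n. lin_on F W (E i) \<and> E i ` W \<subseteq> F" "\<forall>x\<in>fspan F B. D x = (\<Sum>i<n. a i * E i x)" by auto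
    have spW: "subsp F W" using subsp_subfield[OF W FW] .
    have BW: "fspan F B \<subseteq> W" using fspan_least[OF spW] insert by auto
    have dec: "\<exists>c\<in>F. \<exists>y\<in>fspan F B. x = c * b + y" if "x \<in> fspan F (insert b B)" for x
      using that
    proof (induction rule: fspan.induct)
      case zero
      show ?case using subfield_0[OF F] fspan.zero by force
    next
      case (step u e x)
      then obtain c y where *: "c \<in> F" "y \<in> fspan F B" "x = c * b + y" by blast
      show ?case
      proof (cases "e = b")
        case True
        have "u * e + x = (u + c) * b + y" using * True by (simp add: algebra_simps)
        thus ?thesis using * step subfield_add[OF F] by blast
      next
        case False
        have "u * e + x = c * b + (u * e + y)" using * by (simp add: algebra_simps)
        moreover have "u * e + y \<in> fspan F B" using * step False by (auto intro: fspan.step)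
        ultimately show ?thesis using * by blast
      qed
    qed
    show ?case
    proof (cases "b \<in> fspan F B")
      case True
      have "fspan F (insert b B) \<subseteq> fspan F B"
        using True fspan_superset[OF F] by (intro fspan_least subsp_fspan F) auto
      thus ?thesis using E by blast
    next
      case False
      obtain g where g: "lin_on F W g" "\<forall>x\<in>fspan F B. g x = 0" "g b = 1" "g ` W \<subseteq> F"
        by (rule lin_on_functional[OF F fin subsp_fspan[OF F] False])
      \<comment> \<open>The defect of the old combination at \<open>b\<close>. Since
        \<open>g\<close> vanishes on the old span, adding \<open>t * g\<close> repairs
        \<open>b\<close> without spoiling the rest.\<close>
      define t where "t = D b - (\<Sum>i<n. a i * E i b)"
      have bW: "b \<in> W" using insert by auto
      have "D x = (\<Sum>i<Suc n. (a(n := t)) i * (E(n := g)) i x)" if x: "x \<in> fspan F (insert b B)" for x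
      proof -
        obtain c y where *: "c \<in> F" "y \<in> fspan F B" "x = c * b + y" using dec[OF x] by blast
        have yW: "y \<in> W" and cb: "c * b \<in> W" using * BW bW FW subfield_mult[OF W] by auto
        have Ei: "E i x = c * E i b + E i y" if "i < n" for i
          using E(1) that * yW cb bW by (simp add: lin_on_def)
        have "D x = c * D b + D y"
          using D * yW cb bW by (simp add: lin_on_def)
        also have "D y = (\<Sum>i<n. a i * E i y)" using E(2) * by auto
        also have "c * D b + (\<Sum>i<n. a i * E i y) = c * t + (\<Sum>i<n. a i * (c * E i b + E i y))"
          by (simp add: t_def distrib_left sum.distrib sum_distrib_left right_diff_distrib mult.left_commute)
        also have "(\<Sum>i<n. a i * (c * E i b + E i y)) = (\<Sum>i<n. a i * E i x)"
          using Ei by (intro sum.cong) auto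
        also have "c = g x" using g * yW cb bW by (simp add: lin_on_def)
        finally show ?thesis by (simp add: mult.commute add.commute)
      qed
      moreover have "\<forall>i<Suc n. lin_on F W ((E(n := g)) i) \<and> (E(n := g)) i ` W \<subseteq> F"
        using E g by (auto simp: less_Suc_eq)
      ultimately show ?thesis by blast
    qed
  qed
  thus ?thesis using B that by (metis subsetD)
qed

text \<open>If \<open>a i \<noteq> 0\<close>, a \<open>W\<close>-linear functional on the
  \<open>W\<close>-span of the coefficients with value \<open>1\<close> at \<open>a i\<close>
  contracts the relation to one with coefficients in \<open>W\<close>: the values
  \<open>E j x\<close> are in \<open>W\<close> and pass through it.\<close>

lemma sum_independent_extend:
  fixes n :: nat
  assumes W: "is_subfield W" and E: "\<And>i x. i < n \<Longrightarrow> x \<in> W \<Longrightarrow> E i x \<in> W"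
    and ind: "\<And>w. \<forall>i<n. w i \<in> W \<Longrightarrow> \<forall>x\<in>W. (\<Sum>i<n. w i * E i x) = 0 \<Longrightarrow> \<forall>i<n. w i = 0"
    and a: "\<And>x. x \<in> W \<Longrightarrow> (\<Sum>i<n. a i * E i x) = 0" and i: "i < n"
  shows "a i = 0"
proof (rule ccontr)
  assume ai: "a i \<noteq> 0"
  define V where "V = fspan W (a ` {..<n})"
  have sub: "subsp W V" unfolding V_def by (rule subsp_fspan[OF W])
  have aV: "a j \<in> V" if "j < n" for j
    using fspan_superset[OF W] that by (force simp: V_def)
  have fin: "fin_over W V" unfolding fin_over_def
    by (rule exI[of _ "a ` {..<n}"]) (auto simp: aV V_def[symmetric])
  have "subsp W {0}" by (simp add: subsp_def)
  moreover have "a i \<notin> {0}" using ai by simp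
  ultimately obtain g where g: "lin_on W V g" "\<forall>x\<in>{0}. g x = 0" "g (a i) = 1" "g ` V \<subseteq> W"
    by (rule lin_on_functional[OF W fin])
  have "\<forall>j<n. g (a j) = 0"
  proof (rule ind)
    show "\<forall>j<n. g (a j) \<in> W" using g aV by auto
    show "\<forall>x\<in>W. (\<Sum>j<n. g (a j) * E j x) = 0"
    proof
      fix x assume x: "x \<in> W"
      have *: "E j x * a j \<in> V" "g (E j x * a j) = E j x * g (a j)" if "j < n" for j
        using E[OF that x] aV[OF that] sub g by (auto simp: lin_on_def subsp_def)
      have "(\<Sum>j<n. g (a j) * E j x) = (\<Sum>j<n. g (E j x * a j))"
        using * by (intro sum.cong) (auto simp: mult.commute)
      also have "\<dots> = g (\<Sum>j<n. E j x * a j)"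
        using lin_on_sum[OF g(1) sub, of "{..<n}" "\<lambda>j. E j x * a j"] * by simp
      also have "(\<Sum>j<n. E j x * a j) = 0" using a[OF x] by (simp add: mult.commute)
      finally show "(\<Sum>j<n. g (a j) * E j x) = 0" using lin_on_0[OF g(1) subsp_0[OF sub]] by simp
    qed
  qed
  thus False using g i by auto
qed

section \<open>Frobenius images\<close>

definition frob :: "nat \<Rightarrow> 'a::field set \<Rightarrow> 'a set" where
  "frob n W = (\<lambda>x. x ^ (CHAR('a) ^ n)) ` W"

lemma prime_CHAR_field: "CHAR('a::field) > 0 \<Longrightarrow> prime CHAR('a)"
  by (rule prime_CHAR_semidom)

lemma frob_add:
  fixes x y :: "'a::field" assumes "CHAR('a) > 0"
  shows "(x + y) ^ (CHAR('a) ^ n) = x ^ (CHAR('a) ^ n) + y ^ (CHAR('a) ^ n)"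
  by (rule freshmans_dream'[OF prime_CHAR_field[OF assms] refl])

lemma frob_minus:
  fixes x :: "'a::field" assumes p: "CHAR('a) > 0"
  shows "(- x) ^ (CHAR('a) ^ n) = - (x ^ (CHAR('a) ^ n))"
  using frob_add[OF p, of x "- x" n] p by (simp add: power_0_left add_eq_0_iff)

lemma frob_inj:
  fixes x y :: "'a::field" assumes p: "CHAR('a) > 0" and "x ^ (CHAR('a) ^ n) = y ^ (CHAR('a) ^ n)"
  shows "x = y"
proof -
  have "(x - y) ^ (CHAR('a) ^ n) = 0"
    using frob_add[OF p, of x "- y" n] frob_minus[OF p, of y n] assms(2) by simp
  thus ?thesis by simp
qed

lemma frobI: "x \<in> W \<Longrightarrow> (x::'a::field) ^ (CHAR('a) ^ n) \<in> frob n W"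
  by (simp add: frob_def)

lemma frob_mono: "V \<subseteq> W \<Longrightarrow> frob n V \<subseteq> frob n W"
  by (auto simp: frob_def)

lemma frob_frob: "frob m (frob n W) = frob (m + n) W"
  by (force simp: frob_def image_image power_add mult.commute simp flip: power_mult)

lemma frob_0 [simp]: "frob 0 W = W"
  by (simp add: frob_def)

lemma frob_subset: "is_subfield W \<Longrightarrow> frob n W \<subseteq> W"
  by (auto simp: frob_def intro: subfield_power)

lemma frob_antimono: "is_subfield W \<Longrightarrow> m \<le> n \<Longrightarrow> frob n W \<subseteq> frob m W"
  by (metis frob_frob frob_mono frob_subset le_add_diff_inverse)

lemma subfield_frob:
  assumes p: "CHAR('a::field) > 0" and W: "is_subfield (W :: 'a set)"
  shows "is_subfield (frob n W)"
  unfolding is_subfield_def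
proof (intro conjI ballI)
  show "0 \<in> frob n W" using frobI[OF subfield_0[OF W], of n] p by (simp add: power_0_left)
  show "1 \<in> frob n W" using frobI[OF subfield_1[OF W], of n] by simp
  fix x assume "x \<in> frob n W"
  then obtain u where u: "u \<in> W" "x = u ^ (CHAR('a) ^ n)" by (auto simp: frob_def)
  show "- x \<in> frob n W" using frobI[OF subfield_minus[OF W u(1)], of n] u by (simp add: frob_minus[OF p])
  show "inverse x \<in> frob n W"
    using frobI[OF subfield_inverse[OF W u(1)], of n] u by (simp add: power_inverse)
  fix y assume "y \<in> frob n W"
  then obtain v where v: "v \<in> W" "y = v ^ (CHAR('a) ^ n)" by (auto simp: frob_def)
  show "x + y \<in> frob n W"
    using frobI[OF subfield_add[OF W u(1) v(1)], of n] u v by (simp add: frob_add[OF p])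
  show "x * y \<in> frob n W"
    using frobI[OF subfield_mult[OF W u(1) v(1)], of n] u v by (simp add: power_mult_distrib)
qed

lemma frob_fspan:
  assumes p: "CHAR('a::field) > 0" and "x \<in> fspan F (B :: 'a set)"
  shows "x ^ (CHAR('a) ^ n) \<in> fspan (frob n F) (frob n B)"
  using assms(2)
proof (induction rule: fspan.induct)
  case zero thus ?case using p by (simp add: power_0_left fspan.zero)
next
  case (step c b x)
  thus ?case by (auto simp: frob_add[OF p] power_mult_distrib intro!: fspan.step frobI)
qed

lemma fin_over_frob_frob:
  assumes p: "CHAR('a::field) > 0" and "fin_over F (V :: 'a set)"
  shows "fin_over (frob n F) (frob n V)"
proof -
  obtain B where B: "finite B" "B \<subseteq> V" "V \<subseteq> fspan F B" using assms(2) by (auto simp: fin_over_def)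
  have "frob n V \<subseteq> fspan (frob n F) (frob n B)"
    unfolding frob_def[of n V] using frob_fspan[OF p] B by blast
  thus ?thesis using B frob_mono unfolding fin_over_def
    by (intro exI[of _ "frob n B"]) (auto simp: frob_def)
qed

lemma fin_over_refl: "is_subfield F \<Longrightarrow> fin_over F F"
  unfolding fin_over_def by (rule exI[of _ "{1}"]) (force intro: subfield_1 fspan.zero fspan.step[of _ _ 1 _ 0, simplified])

text \<open>Frobenius moves the finiteness of \<open>V\<close> over \<open>V_1\<close> to each layer
  \<open>V_n\<close> over \<open>V_(n+1)\<close>, and the layers compose.\<close>

lemma fin_over_frob:
  assumes p: "CHAR('a::field) > 0" and V: "is_subfield (V :: 'a set)" and 1: "fin_over (frob 1 V) V"
  shows "fin_over (frob n V) V"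
proof (induction n)
  case 0 thus ?case by (simp add: fin_over_refl V)
next
  case (Suc n)
  have 2: "fin_over (frob (Suc n) V) (frob n V)"
    using fin_over_frob_frob[OF p 1, of n] by (simp add: frob_frob)
  show ?case
    by (rule fin_over_trans[OF _ _ V _ _ Suc 2]) (auto simp: subfield_frob p V frob_subset frob_antimono)
qed

section \<open>Perfectness of the core and finiteness of \<open>K\<close> over its
  \<open>p\<close>-th powers\<close>

lemma perfect_core_frob:
  assumes p: "CHAR('a::field) > 0"
  shows "perfect_core CHAR('a) \<subseteq> frob n (perfect_core CHAR('a) :: 'a set)"
proof
  fix c :: 'a assume c: "c \<in> perfect_core CHAR('a)"
  then obtain d where d: "c = d ^ (CHAR('a) ^ n)" by (auto simp: perfect_core_def)
  have "d \<in> perfect_core CHAR('a)" unfolding perfect_core_def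
  proof safe
    fix m
    \<comment> \<open>By uniqueness of \<open>p ^ n\<close>-th roots, a
      \<open>p ^ (m + n)\<close>-th root \<open>e\<close> of \<open>c\<close> exhibits the root
      \<open>d\<close> as a \<open>p ^ m\<close>-th power, for every \<open>m\<close>.\<close>
    obtain e where "c = e ^ (CHAR('a) ^ (m + n))" using c by (auto simp: perfect_core_def)
    hence "(e ^ (CHAR('a) ^ m)) ^ (CHAR('a) ^ n) = d ^ (CHAR('a) ^ n)"
      using d by (simp add: power_add power_mult)
    thus "\<exists>x. d = x ^ CHAR('a) ^ m \<and> True" using frob_inj[OF p] by metis
  qed
  thus "c \<in> frob n (perfect_core CHAR('a))" using d by (auto simp: frob_def)
qed

lemma perfect_core_subset_frob:
  assumes "CHAR('a::field) > 0" "perfect_core CHAR('a) \<subseteq> (W :: 'a set)"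
  shows "perfect_core CHAR('a) \<subseteq> frob n W"
  using perfect_core_frob[OF assms(1)] frob_mono[OF assms(2)] by blast

text \<open>For nonzero \<open>x\<close>, \<open>inverse x = inverse (x ^ n) * x ^ (n - 1)\<close>
  with \<open>x ^ n\<close> in the field \<open>F\<close>, so a ring of this kind is closed under
  inverses.\<close>

lemma subfield_if_power_closed:
  fixes G :: "'a::field set"
  assumes F: "is_subfield F" and FG: "F \<subseteq> G" and sp: "subsp F G"
    and mult: "\<And>x y. x \<in> G \<Longrightarrow> y \<in> G \<Longrightarrow> x * y \<in> G" and n: "n > 0" and pow: "\<And>x. x \<in> G \<Longrightarrow> x ^ n \<in> F"
  shows "is_subfield G"
proof -
  have 1: "1 \<in> G" using FG subfield_1[OF F] by blast
  have pw: "x ^ i \<in> G" if "x \<in> G" for x i using that by (induction i) (auto simp: 1 mult)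
  have "- x \<in> G" if "x \<in> G" for x
    using subsp_smult[OF sp subfield_minus[OF F subfield_1[OF F]] that] by simp
  moreover have "inverse x \<in> G" if "x \<in> G" for x
  proof (cases "x = 0")
    case False
    have "inverse x = inverse (x ^ n) * x ^ (n - 1)"
      using False n by (cases n) (auto simp: field_simps)
    moreover have "inverse (x ^ n) * x ^ (n - 1) \<in> G"
      by (intro subsp_smult[OF sp] subfield_inverse[OF F] pow pw that)
    ultimately show ?thesis by simp
  qed (use that in auto)
  ultimately show ?thesis using sp mult 1 unfolding is_subfield_def subsp_def by blast
qed

lemma fin_over_adjoin1:
  fixes F :: "'a::field set"
  assumes p: "CHAR('a) > 0" and F: "is_subfield F" and pow: "\<And>x. x ^ CHAR('a) \<in> F"
  obtains G where "is_subfield G" "F \<subseteq> G" "s \<in> G" "fin_over F G"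
proof -
  let ?p = "CHAR('a)"
  \<comment> \<open>The \<open>p\<close>-th power of \<open>s\<close> is in \<open>F\<close>, so
    exponents reduce modulo \<open>p\<close> and these powers span the ring generated by
    \<open>s\<close> over \<open>F\<close>.\<close>
  define B where "B = (\<lambda>i. s ^ i) ` {..<?p}"
  define G where "G = fspan F B"
  have p1: "?p > 1" using prime_CHAR_field[OF p] by (rule prime_gt_1_nat)
  have sp: "subsp F G" unfolding G_def by (rule subsp_fspan[OF F])
  have BG: "B \<subseteq> G" unfolding G_def by (rule fspan_superset[OF F])
  have "s ^ 0 \<in> B" using p unfolding B_def by blast
  hence one: "1 \<in> B" by simp
  have "s ^ 1 \<in> B" using p1 unfolding B_def by blast
  hence "s \<in> G" using BG by auto
  have FG: "F \<subseteq> G" using subsp_smult[OF sp _ subsetD[OF BG one]] by auto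
  have pw: "s ^ i \<in> G" for i
  proof -
    have "s ^ i = (s ^ ?p) ^ (i div ?p) * s ^ (i mod ?p)"
      by (simp flip: power_mult power_add)
    moreover have "s ^ (i mod ?p) \<in> G" using BG p by (auto simp: B_def)
    ultimately show ?thesis using subsp_smult[OF sp] subfield_power[OF F pow] by metis
  qed
  have sG: "s ^ i * y \<in> G" if "y \<in> G" for y i
    using that unfolding G_def
  proof (induction rule: fspan.induct)
    case (step c b x)
    obtain j where "b = s ^ j" using step by (auto simp: B_def)
    hence "s ^ i * (c * b + x) = c * s ^ (i + j) + s ^ i * x" by (simp add: algebra_simps power_add)
    thus ?case using step subsp_add[OF sp subsp_smult[OF sp _ pw]] by (simp add: G_def)
  qed (simp add: fspan.zero)
  have mult: "x * y \<in> G" if "x \<in> G" "y \<in> G" for x y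
    using that(1) unfolding G_def
  proof (induction rule: fspan.induct)
    case (step c b x)
    obtain j where "b = s ^ j" using step by (auto simp: B_def)
    hence "(c * b + x) * y = c * (s ^ j * y) + x * y" by (simp add: algebra_simps)
    thus ?case using step subsp_add[OF sp subsp_smult[OF sp _ sG[OF that(2)]]] by (simp add: G_def)
  qed (simp add: fspan.zero)
  have "is_subfield G" by (rule subfield_if_power_closed[OF F FG sp mult p pow])
  moreover have "fin_over F G" unfolding fin_over_def
    by (rule exI[of _ B]) (use BG in \<open>auto simp: G_def B_def\<close>)
  ultimately show ?thesis using that FG \<open>s \<in> G\<close> by blast
qed

lemma fin_over_adjoin:
  fixes F :: "'a::field set"
  assumes p: "CHAR('a) > 0" and F: "is_subfield F" and pow: "\<And>x. x ^ CHAR('a) \<in> F" and S: "finite S"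
  shows "\<exists>G. is_subfield G \<and> F \<subseteq> G \<and> S \<subseteq> G \<and> fin_over F G"
  using S
proof (induction S rule: finite_induct)
  case empty thus ?case using F fin_over_refl by blast
next
  case (insert s S)
  then obtain G where G: "is_subfield G" "F \<subseteq> G" "S \<subseteq> G" "fin_over F G" by blast
  have "x ^ CHAR('a) \<in> G" for x using pow G by blast
  then obtain H where H: "is_subfield H" "G \<subseteq> H" "s \<in> H" "fin_over G H"
    by (rule fin_over_adjoin1[OF p G(1)])
  have "fin_over F H" by (rule fin_over_trans[OF G(1) F H(1,2) G(2) H(4) G(4)])
  thus ?case using G H by blast
qed

text \<open>The core is perfect and hence inside \<open>K^p\<close>, so adjoining the finitely many
  generators to \<open>K^p\<close> yields all of \<open>K\<close>; each step is finite because
  \<open>p\<close>-th powers are already present.\<close>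

lemma fin_gen_imp_fin_over_frob:
  assumes p: "CHAR('a::field) > 0" and fg: "fin_gen_over (perfect_core CHAR('a) :: 'a set)"
  shows "fin_over (frob 1 UNIV) (UNIV :: 'a set)"
proof -
  obtain S :: "'a set" where S: "finite S" "gen_field (perfect_core CHAR('a) \<union> S) = UNIV"
    using fg by (auto simp: fin_gen_over_def)
  have F: "is_subfield (frob 1 (UNIV :: 'a set))" by (rule subfield_frob[OF p subfield_UNIV])
  have "x ^ CHAR('a) \<in> frob 1 UNIV" for x :: 'a using frobI[of x UNIV 1] by simp
  then obtain G :: "'a set" where G: "is_subfield G" "frob 1 UNIV \<subseteq> G" "S \<subseteq> G" "fin_over (frob 1 UNIV) G"
    using fin_over_adjoin[OF p F _ S(1)] by blast
  have "gen_field (perfect_core CHAR('a) \<union> S) \<subseteq> G"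
    using G perfect_core_subset_frob[OF p, of UNIV 1] by (intro gen_field_least) auto
  thus ?thesis using S G by (metis top.extremum_uniqueI)
qed

section \<open>Differential operators are the maps linear over a Frobenius image\<close>

text \<open>The commutator with multiplication by \<open>f\<close>, set up as an operator on maps so
  that it can be iterated with \<open>^^\<close>.\<close>

definition ad :: "'a::field \<Rightarrow> ('a \<Rightarrow> 'a) \<Rightarrow> 'a \<Rightarrow> 'a" where
  "ad f D = (\<lambda>x. D (f * x) - f * D x)"

lemma ad_commute: "ad f (ad g D) = ad g (ad f D)"
  by (simp add: ad_def fun_eq_iff algebra_simps)

lemma ad_funpow_commute: "(ad f ^^ n) (ad g D) = ad g ((ad f ^^ n) D)"
  by (induction n) (simp_all add: ad_commute[of f g])

lemma diff_filt_ad: "diff_filt L R (Suc n) D \<longleftrightarrow> is_End L R D \<and> (\<forall>f\<in>R. diff_filt L R n (ad f D))"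
  by (simp add: ad_def)

declare diff_filt.simps(2) [simp del]

lemma diff_filt_funpow: "diff_filt L R (m + n) D \<Longrightarrow> f \<in> R \<Longrightarrow> diff_filt L R n ((ad f ^^ m) D)"
  by (induction m arbitrary: D) (auto simp: diff_filt_ad funpow_Suc_right simp del: funpow.simps)

text \<open>The coefficients of \<open>(X - f)^n\<close> govern the expansion, because left and right
  multiplication by \<open>f\<close> commute.\<close>
lemma ad_funpow_expand:
  "(ad f ^^ n) D x = (\<Sum>i\<le>n. coeff ([:- f, 1:] ^ n) i * D (f ^ i * x))"
proof (induction n arbitrary: x)
  case 0 thus ?case by simp
next
  case (Suc n)
  define c where "c i = coeff ([:- f, 1:] ^ n) i" for i
  have c0: "c (Suc n) = 0" unfolding c_def
    by (rule coeff_eq_0) (simp add: degree_linear_power)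
  have cf: "coeff ([:- f, 1:] ^ Suc n) i = (case i of 0 \<Rightarrow> 0 | Suc j \<Rightarrow> c j) - f * c i" for i
    by (simp add: c_def coeff_pCons split: nat.splits)
  have "(ad f ^^ Suc n) D x = (\<Sum>i\<le>n. c i * D (f ^ Suc i * x)) - f * (\<Sum>i\<le>n. c i * D (f ^ i * x))"
    by (simp add: ad_def[of f "(ad f ^^ n) D"] Suc c_def mult_ac)
  also have "(\<Sum>i\<le>n. c i * D (f ^ i * x)) = (\<Sum>i\<le>Suc n. c i * D (f ^ i * x))"
    using c0 by simp
  also have "(\<Sum>i\<le>n. c i * D (f ^ Suc i * x)) =
      (\<Sum>i\<le>Suc n. (case i of 0 \<Rightarrow> 0 | Suc j \<Rightarrow> c j) * D (f ^ i * x))"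
    by (subst sum.atMost_Suc_shift) simp
  finally show ?case
    unfolding cf by (simp only: left_diff_distrib sum_subtractf sum_distrib_left mult.assoc)
qed

text \<open>In characteristic \<open>p\<close>, \<open>(X - f) ^ q = X ^ q - f ^ q\<close>, so only
  the two extreme terms of the expansion survive.\<close>

lemma ad_funpow_char:
  fixes f :: "'a::field"
  assumes p: "CHAR('a) > 0" and q: "q = CHAR('a) ^ n"
  shows "(ad f ^^ q) D x = D (f ^ q * x) - f ^ q * D x"
proof -
  have q0: "q > 0" using p q by simp
  have pr: "prime CHAR('a poly)" using prime_CHAR_field[OF p] by simp
  have "[:- f, 1:] = monom 1 1 + [:- f:]" by (simp add: monom_altdef)
  hence "[:- f, 1:] ^ q = monom 1 1 ^ q + [:- f:] ^ q"
    using freshmans_dream'[OF pr, of q n "monom 1 1" "[:- f:]"] q by simp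
  also have "[:- f:] ^ q = [: - (f ^ q) :]" using frob_minus[OF p, of f n] q by (simp add: poly_const_pow)
  also have "monom (1::'a) 1 ^ q = monom 1 q" by (simp add: monom_power)
  finally have "coeff ([:- f, 1:] ^ q) i = (if i = q then 1 else if i = 0 then - (f ^ q) else 0)" for i
    using q0 by (auto simp: coeff_pCons split: nat.splits)
  hence "(ad f ^^ q) D x = (\<Sum>i\<le>q. (if i = q then 1 else if i = 0 then - (f ^ q) else 0) * D (f ^ i * x))"
    by (simp add: ad_funpow_expand)
  also have "\<dots> = (\<Sum>i\<in>{0, q}. (if i = q then 1 else if i = 0 then - (f ^ q) else 0) * D (f ^ i * x))"
    by (rule sum.mono_neutral_right) auto
  finally show ?thesis using q0 by simp
qed

text \<open>The \<open>n\<close>-fold commutators of \<open>D\<close> vanish on \<open>R\<close>,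
  hence so do the \<open>q\<close>-fold ones for a power \<open>q > n\<close> of \<open>p\<close>;
  and vanishing of \<open>ad (f ^ q) D\<close> says that \<open>f ^ q\<close> passes through
  \<open>D\<close>.\<close>

lemma Diff_imp_frob_linear:
  fixes R :: "'a::field set"
  assumes p: "CHAR('a) > 0" and R: "is_subfield R" and D: "is_Diff L R D"
  obtains n where "lin_on (frob n R) R D"
proof -
  obtain n where n: "diff_filt L R n D" using D by (auto simp: is_Diff_def)
  define q where "q = CHAR('a) ^ n"
  have "n < q" unfolding q_def
    using prime_gt_1_nat[OF prime_CHAR_field[OF p]] by (intro power_gt_expt) simp
  have add: "D (x + y) = D x + D y" if "x \<in> R" "y \<in> R" for x y
    using n that subfield_add[OF R] by (cases n) (auto simp: diff_filt_ad is_End_def)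
  have "D (f ^ q * x) = f ^ q * D x" if "f \<in> R" "x \<in> R" for f x
  proof -
    have "diff_filt L R 0 ((ad f ^^ n) D)" using diff_filt_funpow[of L R n 0 D f] n that by simp
    hence 0: "(ad f ^^ n) D y = 0" if "y \<in> R" for y using that by simp
    have "(ad f ^^ (m + n)) D y = 0" if "y \<in> R" for m y
      using that \<open>f \<in> R\<close> by (induction m arbitrary: y) (auto simp: 0 ad_def subfield_mult[OF R])
    from this[of x "q - n"] have "(ad f ^^ q) D x = 0" using \<open>n < q\<close> that by simp
    thus ?thesis using ad_funpow_char[OF p q_def, of f D x] by simp
  qed
  hence "lin_on (frob n R) R D" by (auto simp: lin_on_def add frob_def q_def)
  thus ?thesis by (rule that)
qed

text \<open>Operators on \<open>R\<close> are total functions whose values off \<open>R\<close>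
  carry no meaning, so changes there must be seen to preserve the filtration.\<close>

lemma diff_filt_cong:
  assumes R: "is_subfield R" "L \<subseteq> R" and "\<And>x. x \<in> R \<Longrightarrow> D x = D' x" "diff_filt L R n D"
  shows "diff_filt L R n D'"
  using assms(3,4)
proof (induction n arbitrary: D D')
  case (Suc n)
  have "is_End L R D" using Suc.prems(2) by (simp add: diff_filt_ad)
  hence "is_End L R D'"
    using R(2) subfield_add[OF R(1)] subfield_mult[OF R(1)]
    by (auto simp: is_End_def subset_iff Suc.prems(1)[symmetric])
  moreover have "diff_filt L R n (ad f D')" if "f \<in> R" for f
    by (rule Suc.IH[of "ad f D"]) (use Suc.prems that subfield_mult[OF R(1)] in \<open>auto simp: ad_def diff_filt_ad\<close>)
  ultimately show ?case by (simp add: diff_filt_ad)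
qed auto

lemma diff_filt_lincomb:
  assumes R: "is_subfield R" "L \<subseteq> R" and "diff_filt L R n D" "diff_filt L R n D'" "c \<in> R"
  shows "diff_filt L R n (\<lambda>x. c * D x + D' x)"
  using assms(3,4)
proof (induction n arbitrary: D D')
  case (Suc n)
  have "is_End L R (\<lambda>x. c * D x + D' x)"
    using Suc.prems assms(5) by (auto simp: diff_filt_ad is_End_def algebra_simps intro: subfield_add[OF R(1)] subfield_mult[OF R(1)])
  moreover have "diff_filt L R n (ad f (\<lambda>x. c * D x + D' x))" if "f \<in> R" for f
  proof -
    have "diff_filt L R n (\<lambda>x. c * ad f D x + ad f D' x)"
      using Suc that by (auto simp: diff_filt_ad)
    thus ?thesis by (simp add: ad_def algebra_simps)
  qed
  ultimately show ?case by (simp add: diff_filt_ad)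
qed auto

lemma diff_filt_zero:
  assumes R: "is_subfield R" "L \<subseteq> R" and "\<And>x. x \<in> R \<Longrightarrow> D x = 0"
  shows "diff_filt L R n D"
proof -
  have "diff_filt L R n (\<lambda>_. 0)"
  proof (induction n)
    case (Suc n)
    thus ?case by (simp add: diff_filt_ad is_End_def subfield_0[OF R(1)] ad_def)
  qed auto
  thus ?thesis by (rule diff_filt_cong[OF R, rotated]) (simp add: assms(3))
qed

text \<open>Pigeonhole: in a long enough iterated commutator some generator \<open>b\<close> of \<open>R\<close> over \<open>F\<close>
  occurs at least \<open>m b\<close> times.\<close>
lemma diff_filt_if_nilpotent:
  assumes F: "is_subfield F" and R: "is_subfield R" and FR: "F \<subseteq> R" and LF: "L \<subseteq> F"
    and B: "finite B" "B \<subseteq> R" "R \<subseteq> fspan F B"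
    and D: "lin_on F R D" "D ` R \<subseteq> R" "\<And>b x. b \<in> B \<Longrightarrow> x \<in> R \<Longrightarrow> (ad b ^^ m b) D x = 0"
  shows "diff_filt L R (sum m B) D"
  using D
proof (induction "sum m B" arbitrary: m D)
  have LR: "L \<subseteq> R" using LF FR by blast
  have B0: "B \<noteq> {}"
  proof
    assume "B = {}"
    have "x = 0" if "x \<in> fspan F {}" for x using that by (cases rule: fspan.cases) auto
    thus False using B \<open>B = {}\<close> subfield_1[OF R] by fastforce
  qed
  { case 0
    \<comment> \<open>The \<open>0\<close>-fold commutator is \<open>D\<close> itself, so a single
      exponent \<open>0\<close> makes \<open>D\<close> vanish on \<open>R\<close>; as
      \<open>B\<close> is nonempty, there is one.\<close>
    then obtain b where "b \<in> B" "m b = 0" using B0 B by auto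
    hence "D x = 0" if "x \<in> R" for x using 0(4)[of b x] that by simp
    thus ?case using 0(1) by simp }
  { case (Suc N)
    show ?case
    proof (cases "\<exists>b\<in>B. m b = 0")
      case True
      then obtain b where b: "b \<in> B" "m b = 0" by blast
      hence "D x = 0" if "x \<in> R" for x using Suc.prems(3)[of b x] that by simp
      thus ?thesis by (rule diff_filt_zero[OF R LR])
    next
      case False
      have lin: "D (c * x + y) = c * D x + D y" if "c \<in> F" "x \<in> R" "y \<in> R" for c x y
        using Suc.prems(1) that FR subfield_mult[OF R] by (auto simp: lin_on_def)
      have D0: "D 0 = 0" using lin_on_0[OF Suc.prems(1) subfield_0[OF R]] .
      have b: "diff_filt L R N (ad b D)" if b: "b \<in> B" for b
      proof -
        \<comment> \<open>One commutator with \<open>b\<close> has been spent, so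
          \<open>ad b D\<close> needs one less. The other exponents stay, because commutators
          commute, and the total drops to \<open>N\<close>.\<close>
        define m' where "m' = m(b := m b - 1)"
        have bR: "b \<in> R" using b B by auto
        have "sum m' B = sum m (B - {b}) + (m b - 1)"
          using b B(1) by (simp add: m'_def sum.remove[of B b])
        moreover have "sum m B = sum m (B - {b}) + m b" using b B(1) by (simp add: sum.remove[of B b])
        ultimately have N: "N = sum m' B" using Suc.hyps(2) False b by (metis Suc_diff_1 add_Suc_right gr0I nat.inject)
        have "lin_on F R (ad b D)" unfolding lin_on_def
        proof (intro conjI ballI)
          fix x y assume x: "x \<in> R"
          { assume y: "y \<in> R"
            show "ad b D (x + y) = ad b D x + ad b D y"
              using x y bR subfield_mult[OF R] Suc.prems(1) by (simp add: ad_def lin_on_def distrib_left) }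
          { fix c assume c: "c \<in> F"
            have "D (b * (c * x)) = c * D (b * x)"
              using lin_on_smult[OF Suc.prems(1) c subfield_mult[OF R bR x]] by (simp add: mult.left_commute)
            thus "ad b D (c * x) = c * ad b D x"
              using x c Suc.prems(1) by (simp add: ad_def lin_on_def algebra_simps) }
        qed
        moreover have "ad b D ` R \<subseteq> R"
          using Suc.prems(2) bR by (auto simp: ad_def intro!: subfield_diff[OF R] subfield_mult[OF R])
        moreover have "(ad e ^^ m' e) (ad b D) x = 0" if e: "e \<in> B" and x: "x \<in> R" for e x
        proof (cases "e = b")
          case True
          have "(ad b ^^ m' b) (ad b D) = (ad b ^^ (Suc (m' b))) D"
            by (simp only: funpow_Suc_right comp_apply)
          also have "Suc (m' b) = m b" using False b by (auto simp: m'_def)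
          finally show ?thesis using Suc.prems(3)[OF e x] True by simp
        next
          case ne: False
          hence "m' e = m e" by (simp add: m'_def)
          thus ?thesis using Suc.prems(3)[OF e] x subfield_mult[OF R bR x]
            by (simp add: ad_funpow_commute) (simp add: ad_def)
        qed
        ultimately show ?thesis using Suc.hyps(1)[OF N] N by metis
      qed
      have "diff_filt L R N (ad f D)" if "f \<in> R" for f
      proof -
        \<comment> \<open>By \<open>F\<close>-linearity of \<open>D\<close>,
          \<open>ad (c * e + f) D = c * ad e D + ad f D\<close> on \<open>R\<close> for
          \<open>c \<in> F\<close>, so commutators with generators suffice.\<close>
        have "f \<in> fspan F B" using that B by blast
        hence "f \<in> R \<and> diff_filt L R N (ad f D)"
        proof (induction rule: fspan.induct)
          case zero
          show ?case by (auto simp: ad_def D0 subfield_0[OF R] intro: diff_filt_zero[OF R LR])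
        next
          case (step c e f)
          have cR: "c \<in> R" and eR: "e \<in> R" using step FR B by auto
          have "diff_filt L R N (\<lambda>x. c * ad e D x + ad f D x)"
            using step b cR by (intro diff_filt_lincomb[OF R LR]) auto
          moreover have "c * ad e D x + ad f D x = ad (c * e + f) D x" if "x \<in> R" for x
          proof -
            have "(c * e + f) * x = c * (e * x) + f * x" by (simp add: algebra_simps)
            thus ?thesis using lin[of c "e * x" "f * x"] step that eR subfield_mult[OF R]
              by (simp add: ad_def algebra_simps)
          qed
          ultimately have "diff_filt L R N (ad (c * e + f) D)" by (rule diff_filt_cong[OF R LR, rotated])
          thus ?case using cR eR step subfield_add[OF R] subfield_mult[OF R] by auto
        qed
        thus ?thesis by simp
      qed
      moreover have "is_End L R D"
        using Suc.prems LF by (auto simp: is_End_def lin_on_def)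
      ultimately show ?thesis unfolding Suc.hyps(2)[symmetric] by (simp add: diff_filt_ad)
    qed }
qed

text \<open>The \<open>p ^ n\<close>-th power of each generator is in \<open>F\<close> and commutes
  with \<open>D\<close>, so iterated commutators with generators vanish. \<open>F\<close> may be an
  intermediate field because the kernel calls for maps linear over a compositum.\<close>

lemma linear_imp_Diff:
  fixes R :: "'a::field set"
  assumes p: "CHAR('a) > 0" and F: "is_subfield F" and R: "is_subfield R" and FR: "F \<subseteq> R"
    and nF: "frob n R \<subseteq> F" and fin: "fin_over F R" and LF: "L \<subseteq> F"
    and D: "lin_on F R D" "D ` R \<subseteq> R"
  shows "is_Diff L R D"
proof -
  obtain B where B: "finite B" "B \<subseteq> R" "R \<subseteq> fspan F B" using fin by (auto simp: fin_over_def)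
  have "(ad b ^^ (CHAR('a) ^ n)) D x = 0" if "b \<in> B" "x \<in> R" for b x
  proof -
    have "b ^ (CHAR('a) ^ n) \<in> F" using that B nF frobI by blast
    thus ?thesis using D(1) that by (simp add: ad_funpow_char[OF p refl] lin_on_def)
  qed
  thus ?thesis unfolding is_Diff_def
    using diff_filt_if_nilpotent[OF F R FR LF B D, of "\<lambda>_. CHAR('a) ^ n"] by blast
qed

section \<open>Polynomials with coefficients in a subset\<close>

text \<open>\<open>S\<close> is an arbitrary set, as coefficients are also drawn from subspaces such
  as \<open>fspan F C\<close>. Keeping the ambient polynomial type allows evaluation at any
  \<open>x\<close>.\<close>

definition pol :: "'a::field set \<Rightarrow> 'a poly set" where
  "pol S = {g. \<forall>i. coeff g i \<in> S}"

lemma pol_0: "0 \<in> S \<Longrightarrow> 0 \<in> pol S"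
  by (simp add: pol_def)

lemma pol_const: "is_subfield W \<Longrightarrow> a \<in> W \<Longrightarrow> [:a:] \<in> pol W"
  by (auto simp: pol_def coeff_pCons subfield_0 split: nat.splits)

lemma pol_monom: "is_subfield W \<Longrightarrow> a \<in> W \<Longrightarrow> monom a n \<in> pol W"
  by (auto simp: pol_def subfield_0)

lemma pol_add: "subsp F S \<Longrightarrow> g \<in> pol S \<Longrightarrow> h \<in> pol S \<Longrightarrow> g + h \<in> pol S"
  by (auto simp: pol_def subsp_add)

lemma pol_mult: "subsp F S \<Longrightarrow> u \<in> pol F \<Longrightarrow> g \<in> pol S \<Longrightarrow> u * g \<in> pol S"
  by (auto simp: pol_def coeff_mult intro!: subsp_sum subsp_smult)

lemma pol_minus: "is_subfield W \<Longrightarrow> g \<in> pol W \<Longrightarrow> - g \<in> pol W"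
  by (auto simp: pol_def subfield_minus)

lemma pol_mono: "F \<subseteq> W \<Longrightarrow> pol F \<subseteq> pol W"
  by (auto simp: pol_def)

lemma subsp_self: "is_subfield W \<Longrightarrow> subsp W W"
  by (simp add: subsp_subfield)

lemmas pol_field_add = pol_add[OF subsp_self]
lemmas pol_field_mult = pol_mult[OF subsp_self]

lemma pol_division:
  assumes W: "is_subfield W" and g: "g \<in> pol W" "g \<noteq> 0" and f: "f \<in> pol W"
  shows "\<exists>s\<in>pol W. \<exists>r\<in>pol W. f = g * s + r \<and> (r = 0 \<or> degree r < degree g)"
  using f
proof (induction "degree f" arbitrary: f rule: less_induct)
  case less
  show ?case
  proof (cases "f = 0 \<or> degree f < degree g")
    case True
    thus ?thesis using less.prems pol_0[OF subfield_0[OF W]] by (intro bexI[of _ 0] bexI[of _ f]) auto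
  next
    case False
    define t where "t = monom (lead_coeff f * inverse (lead_coeff g)) (degree f - degree g)"
    define f' where "f' = f + - (g * t)"
    have t: "t \<in> pol W" unfolding t_def using g less.prems
      by (intro pol_monom[OF W] subfield_mult[OF W] subfield_inverse[OF W]) (auto simp: pol_def)
    have f': "f' \<in> pol W" unfolding f'_def
      by (intro pol_field_add[OF W] pol_minus[OF W] pol_field_mult[OF W] less.prems g t)
    have tn: "t \<noteq> 0" using False g by (simp add: t_def)
    have deg: "degree (g * t) = degree f"
    proof -
      have "degree t = degree f - degree g" unfolding t_def
        by (rule degree_monom_eq) (use False g in simp)
      thus ?thesis using False g tn by (simp add: degree_mult_eq)
    qed
    have "lead_coeff (g * t) = lead_coeff f"
    proof -
      have "lead_coeff t = lead_coeff f * inverse (lead_coeff g)"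
        unfolding t_def by (rule lead_coeff_monom)
      thus ?thesis using g by (simp only: lead_coeff_mult) simp
    qed
    hence 0: "coeff f' (degree f) = 0" using deg by (simp add: f'_def)
    have le: "degree f' \<le> degree f" unfolding f'_def using deg by (intro degree_add_le) auto
    have "\<exists>s\<in>pol W. \<exists>r\<in>pol W. f' = g * s + r \<and> (r = 0 \<or> degree r < degree g)"
    proof (cases "f' = 0")
      case True
      thus ?thesis using pol_0[OF subfield_0[OF W]] by (intro bexI[of _ 0]) auto
    next
      case False
      hence "degree f' \<noteq> degree f" using 0 leading_coeff_0_iff by metis
      thus ?thesis using less.hyps[OF _ f'] le by simp
    qed
    then obtain s r where "s \<in> pol W" "r \<in> pol W" "f' = g * s + r" "r = 0 \<or> degree r < degree g" by blast
    moreover from this have "f = g * (s + t) + r" by (simp add: f'_def algebra_simps)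
    ultimately show ?thesis using t pol_field_add[OF W] by blast
  qed
qed

text \<open>By the freshman's dream the coefficients of the power are powers of those of
  \<open>g\<close>, spread out to exponents divisible by \<open>p ^ n\<close>.\<close>

lemma pol_power_frob:
  fixes g :: "'a::field poly"
  assumes p: "CHAR('a) > 0" and W: "is_subfield W" and "g \<in> pol W"
  shows "g ^ (CHAR('a) ^ n) \<in> pol (frob n W)"
  using assms(3)
proof (induction g)
  case 0 thus ?case using p pol_0[OF subfield_0[OF subfield_frob[OF p W]]] by (simp add: power_0_left)
next
  case (pCons a g)
  let ?q = "CHAR('a) ^ n"
  have pr: "prime CHAR('a poly)" using prime_CHAR_field[OF p] by simp
  note F = subfield_frob[OF p W, of n]
  have cW: "coeff (pCons a g) i \<in> W" for i using pCons.prems by (simp add: pol_def)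
  have a: "a \<in> W" using cW[of 0] by simp
  have g: "g \<in> pol W" unfolding pol_def using cW[of "Suc _"] by simp
  have "pCons a g = [:a:] + monom 1 1 * g" by (simp add: monom_altdef)
  hence "pCons a g ^ ?q = [:a:] ^ ?q + (monom 1 1 * g) ^ ?q"
    using freshmans_dream'[OF pr, of ?q n "[:a:]" "monom 1 1 * g"] by simp
  also have "\<dots> = [:a ^ ?q:] + monom 1 ?q * g ^ ?q"
    by (simp add: power_mult_distrib monom_power poly_const_pow)
  finally show ?case
    using pCons.IH[OF g] frobI[OF a, of n] subfield_1[OF F]
    by (auto intro!: pol_field_add[OF F] pol_field_mult[OF F] pol_const[OF F] pol_monom[OF F])
qed

text \<open>Frobenius on the coefficients alone: unlike the power of \<open>g\<close>, this keeps
  the degree, but it has to be evaluated at the power of \<open>x\<close>.\<close>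

definition poly_frob :: "nat \<Rightarrow> 'a::field poly \<Rightarrow> 'a poly" where
  "poly_frob n g = map_poly (\<lambda>a. a ^ (CHAR('a) ^ n)) g"

lemma coeff_poly_frob:
  "CHAR('a::field) > 0 \<Longrightarrow> coeff (poly_frob n g) i = (coeff g i :: 'a) ^ (CHAR('a) ^ n)"
  by (simp add: poly_frob_def coeff_map_poly power_0_left)

lemma pol_poly_frob: "CHAR('a::field) > 0 \<Longrightarrow> g \<in> pol (W :: 'a set) \<Longrightarrow> poly_frob n g \<in> pol (frob n W)"
  by (auto simp: pol_def coeff_poly_frob frobI)

lemma degree_poly_frob: "degree (poly_frob n g) = degree g"
  unfolding poly_frob_def by (rule degree_map_poly) simp

lemma poly_poly_frob:
  fixes x :: "'a::field"
  assumes p: "CHAR('a) > 0"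
  shows "poly (poly_frob n g) (x ^ (CHAR('a) ^ n)) = poly g x ^ (CHAR('a) ^ n)"
proof (induction g)
  case 0 thus ?case using p by (simp add: poly_frob_def power_0_left)
next
  case (pCons a g)
  have "poly_frob n (pCons a g) = pCons (a ^ (CHAR('a) ^ n)) (poly_frob n g)"
    using p unfolding poly_frob_def by (intro map_poly_pCons) (simp add: power_0_left)
  thus ?case using pCons by (simp add: frob_add[OF p] power_mult_distrib)
qed

lemma map_poly_lin_add:
  assumes E: "lin_on F W E" and W: "is_subfield W" and "r \<in> pol W" "s \<in> pol W"
  shows "map_poly E (r + s) = map_poly E r + map_poly E s"
  using assms(3,4) lin_on_0[OF E subfield_0[OF W]]
  by (intro poly_eqI) (simp add: coeff_map_poly pol_def lin_on_add[OF E])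

text \<open>Coefficientwise application is the base change of \<open>E\<close> to polynomials, so
  \<open>F\<close>-linearity becomes linearity over polynomials with coefficients in
  \<open>F\<close>.\<close>

lemma map_poly_lin_mult:
  assumes E: "lin_on F W E" and W: "is_subfield W" and FW: "F \<subseteq> W" and u: "u \<in> pol F" and r: "r \<in> pol W"
  shows "map_poly E (u * r) = u * map_poly E r"
proof (rule poly_eqI)
  fix n
  note E0 = lin_on_0[OF E subfield_0[OF W]]
  have sp: "subsp F W" by (rule subsp_subfield[OF W FW])
  have "E (\<Sum>i\<le>n. coeff u i * coeff r (n - i)) = (\<Sum>i\<le>n. E (coeff u i * coeff r (n - i)))"
    using lin_on_sum[OF E sp, of "{..n}" "\<lambda>i. coeff u i * coeff r (n - i)"] u r subsp_smult[OF sp]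
    by (auto simp: pol_def)
  also have "\<dots> = (\<Sum>i\<le>n. coeff u i * E (coeff r (n - i)))"
    using u r lin_on_smult[OF E] by (intro sum.cong) (auto simp: pol_def)
  finally show "coeff (map_poly E (u * r)) n = coeff (u * map_poly E r) n"
    using E0 by (simp add: coeff_map_poly coeff_mult)
qed

lemma map_poly_lin_const:
  assumes E: "lin_on F W E" and W: "is_subfield W" and FW: "F \<subseteq> W" and u: "u \<in> pol F" and w: "w \<in> W"
  shows "map_poly E (smult w u) = smult (E w) u"
proof -
  have "map_poly E (u * [:w:]) = u * map_poly E [:w:]"
    by (rule map_poly_lin_mult[OF E W FW u pol_const[OF W w]])
  also have "map_poly E [:w:] = [:E w:]"
    using lin_on_0[OF E subfield_0[OF W]] by (simp add: map_poly_pCons)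
  finally show ?thesis by (simp add: mult.commute)
qed

section \<open>Simple extensions\<close>

abbreviation adjoin :: "'a::field set \<Rightarrow> 'a \<Rightarrow> 'a set" where
  "adjoin W x \<equiv> gen_field (insert x W)"

lemma adjoin_superset: "W \<subseteq> adjoin W x" "x \<in> adjoin W x"
  using gen_field_superset[of "insert x W"] by auto

text \<open>Fractions of polynomial values at \<open>x\<close> already form a field containing
  \<open>W\<close> and \<open>x\<close>.\<close>

lemma adjoin_fraction:
  assumes W: "is_subfield W" and y: "y \<in> adjoin W x"
  obtains g h where "g \<in> pol W" "h \<in> pol W" "poly h x \<noteq> 0" "y * poly h x = poly g x"
proof -
  define A where "A = {y. \<exists>g\<in>pol W. \<exists>h\<in>pol W. poly h x \<noteq> 0 \<and> y * poly h x = poly g x}"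
  have AI: "y \<in> A" if "g \<in> pol W" "h \<in> pol W" "poly h x \<noteq> 0" "y * poly h x = poly g x" for y g h
    using that by (auto simp: A_def)
  note c = pol_const[OF W subfield_1[OF W]] pol_const[OF W subfield_0[OF W]]
  have "is_subfield A" unfolding is_subfield_def
  proof (intro conjI ballI)
    show "0 \<in> A" by (rule AI[OF c(2,1)]) auto
    show "1 \<in> A" by (rule AI[OF c(1,1)]) auto
    fix y assume "y \<in> A"
    then obtain g h where y: "g \<in> pol W" "h \<in> pol W" "poly h x \<noteq> 0" "y * poly h x = poly g x" by (auto simp: A_def)
    show "- y \<in> A" by (rule AI[OF pol_minus[OF W y(1)] y(2,3)]) (simp add: y)
    show "inverse y \<in> A"
    proof (cases "y = 0")
      case True thus ?thesis using \<open>0 \<in> A\<close> by simp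
    next
      case False
      have "poly g x \<noteq> 0" using y False by (metis mult_eq_0_iff)
      moreover have "inverse y * poly g x = poly h x" using y(4) False by (simp flip: y(4) add: field_simps)
      ultimately show ?thesis by (rule AI[OF y(2,1)])
    qed
    fix z assume "z \<in> A"
    then obtain g' h' where z: "g' \<in> pol W" "h' \<in> pol W" "poly h' x \<noteq> 0" "z * poly h' x = poly g' x" by (auto simp: A_def)
    have "(y + z) * poly (h * h') x = poly (g * h' + g' * h) x"
      by (simp flip: y(4) z(4) add: algebra_simps)
    thus "y + z \<in> A"
      using y z by (intro AI[of "g * h' + g' * h" "h * h'"] pol_field_add[OF W] pol_field_mult[OF W]) auto
    have "(y * z) * poly (h * h') x = poly (g * g') x" by (simp flip: y(4) z(4) add: algebra_simps)
    thus "y * z \<in> A"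
      using y z by (intro AI[of "g * g'" "h * h'"] pol_field_mult[OF W]) auto
  qed
  moreover have "w \<in> A" if "w \<in> W" for w by (rule AI[OF pol_const[OF W that] c(1)]) auto
  moreover have "x \<in> A" using pol_monom[OF W subfield_1[OF W], of 1]
    by (intro AI[OF _ c(1)]) (auto simp: poly_monom)
  ultimately have "adjoin W x \<subseteq> A" by (intro gen_field_least) auto
  thus ?thesis using y that by (auto simp: A_def)
qed

text \<open>Raising numerator and denominator to the power moves their coefficients into
  \<open>W_n\<close> while keeping the evaluation point \<open>x\<close>.\<close>

lemma frob_adjoin_fraction:
  fixes x :: "'a::field"
  assumes p: "CHAR('a) > 0" and W: "is_subfield W" and c: "c \<in> frob n (adjoin W x)"
  obtains u v where "u \<in> pol (frob n W)" "v \<in> pol (frob n W)" "poly v x \<noteq> 0" "c * poly v x = poly u x"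
proof -
  obtain y where y: "y \<in> adjoin W x" "c = y ^ (CHAR('a) ^ n)" using c by (auto simp: frob_def)
  obtain g h where gh: "g \<in> pol W" "h \<in> pol W" "poly h x \<noteq> 0" "y * poly h x = poly g x"
    by (rule adjoin_fraction[OF W y(1)])
  show ?thesis
    by (rule that[OF pol_power_frob[OF p W gh(1)] pol_power_frob[OF p W gh(2)]])
      (use gh y in \<open>auto simp flip: power_mult_distrib\<close>)
qed

text \<open>Only a lower bound, which need not be attained, so that one number can be demanded at
  all Frobenius powers of \<open>x\<close> at once.\<close>

definition min_degree :: "'a::field set \<Rightarrow> 'a \<Rightarrow> nat \<Rightarrow> bool" where
  "min_degree W x d \<longleftrightarrow> (\<forall>g\<in>pol W. g \<noteq> 0 \<longrightarrow> poly g x = 0 \<longrightarrow> d \<le> degree g)"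

text \<open>Euclid's argument: a nonzero remainder \<open>r\<close> of \<open>m\<close> by
  \<open>g\<close> has smaller degree than \<open>g\<close> and \<open>r(x) = - g(x) s(x)\<close>,
  so an inverse of \<open>r(x)\<close> gives one of \<open>g(x)\<close>.\<close>

lemma adjoin_inverse:
  assumes W: "is_subfield W" and m: "m \<in> pol W" "m \<noteq> 0" "poly m x = 0" "min_degree W x (degree m)"
    and g: "g \<in> pol W" "g \<noteq> 0" "degree g < degree m"
  shows "\<exists>h\<in>pol W. poly g x * poly h x = 1"
  using g
proof (induction "degree g" arbitrary: g rule: less_induct)
  case less
  obtain s r where sr: "s \<in> pol W" "r \<in> pol W" "m = g * s + r" "r = 0 \<or> degree r < degree g"
    using pol_division[OF W less.prems(1,2) m(1)] by blast
  show ?case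
  proof (cases "r = 0")
    \<comment> \<open>Here \<open>g\<close> divides \<open>m\<close>. Minimality gives
      \<open>s(x) = 0\<close> and then \<open>degree s \<ge> degree m\<close>, so \<open>g\<close>
      is constant.\<close>
    case True
    have s0: "s \<noteq> 0" using sr True m by auto
    have "poly g x \<noteq> 0" using m(4) less.prems by (auto simp: min_degree_def)
    hence "poly s x = 0" using sr True m(3) by simp
    hence "degree m \<le> degree s" using m(4) sr s0 by (auto simp: min_degree_def)
    moreover have "degree m = degree g + degree s" using sr True s0 less.prems by (simp add: degree_mult_eq)
    ultimately have "degree g = 0" by simp
    then obtain a where a: "g = [:a:]" by (rule degree_eq_zeroE)
    hence "a \<noteq> 0" "a \<in> W" using less.prems by (auto simp: pol_def coeff_pCons split: nat.splits)
    thus ?thesis using a pol_const[OF W subfield_inverse[OF W]] by (intro bexI[of _ "[:inverse a:]"]) auto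
  next
    case False
    then obtain t where t: "t \<in> pol W" "poly r x * poly t x = 1"
      using less.hyps[of r] sr less.prems by auto
    have "poly r x = - (poly g x * poly s x)" using m(3) sr(3) by (simp add: eq_neg_iff_add_eq_0 add.commute)
    hence "poly g x * poly (- (s * t)) x = 1" using t(2) by (simp add: algebra_simps)
    thus ?thesis using pol_minus[OF W pol_field_mult[OF W sr(1) t(1)]] by blast
  qed
qed

text \<open>Remainders modulo \<open>m\<close> represent all polynomial values at \<open>x\<close>,
  and these values form a field since nonzero remainders are invertible there.\<close>

lemma adjoin_algebraic:
  assumes W: "is_subfield W" and m: "m \<in> pol W" "m \<noteq> 0" "poly m x = 0" "min_degree W x (degree m)"
    and y: "y \<in> adjoin W x"
  obtains g where "g \<in> pol W" "degree g < degree m" "y = poly g x"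
proof -
  have d0: "degree m > 0"
  proof (rule ccontr)
    assume "\<not> degree m > 0"
    then obtain a where "m = [:a:]" by (metis degree_eq_zeroE gr0I)
    thus False using m by simp
  qed
  define A where "A = {poly g x | g. g \<in> pol W}"
  have AI: "poly g x \<in> A" if "g \<in> pol W" for g using that by (auto simp: A_def)
  have red: "\<exists>g\<in>pol W. degree g < degree m \<and> y = poly g x" if yA: "y \<in> A" for y
  proof -
    obtain f where f: "f \<in> pol W" "y = poly f x" using yA unfolding A_def by blast
    obtain s r where "s \<in> pol W" "r \<in> pol W" "f = m * s + r" "r = 0 \<or> degree r < degree m"
      using pol_division[OF W m(1,2) f(1)] by blast
    thus ?thesis using f d0 m(3) by (intro bexI[of _ r]) auto
  qed
  have "is_subfield A" unfolding is_subfield_def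
  proof (intro conjI ballI)
    show "0 \<in> A" using AI[OF pol_const[OF W subfield_0[OF W]]] by simp
    show "1 \<in> A" using AI[OF pol_const[OF W subfield_1[OF W]]] by simp
    fix y assume yA: "y \<in> A"
    then obtain g where g: "g \<in> pol W" "degree g < degree m" "y = poly g x" using red by blast
    show "- y \<in> A" using AI[OF pol_minus[OF W g(1)]] g by simp
    show "inverse y \<in> A"
    proof (cases "g = 0")
      case True thus ?thesis using g \<open>0 \<in> A\<close> by simp
    next
      case False
      obtain h where "h \<in> pol W" "poly g x * poly h x = 1"
        using adjoin_inverse[OF W m g(1) False g(2)] by blast
      thus ?thesis using AI g(3) inverse_unique by metis
    qed
    fix z assume "z \<in> A"
    then obtain h where h: "h \<in> pol W" "z = poly h x" by (auto simp: A_def)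
    show "y + z \<in> A" using AI[OF pol_field_add[OF W g(1) h(1)]] g h by simp
    show "y * z \<in> A" using AI[OF pol_field_mult[OF W g(1) h(1)]] g h by simp
  qed
  moreover have "w \<in> A" if "w \<in> W" for w using AI[OF pol_const[OF W that]] by simp
  moreover have "x \<in> A" using AI[OF pol_monom[OF W subfield_1[OF W], of 1]] by (simp add: poly_monom)
  ultimately have "adjoin W x \<subseteq> A" by (intro gen_field_least) auto
  thus ?thesis using y red that by blast
qed

lemma min_poly_exists:
  assumes "m \<in> pol W" "m \<noteq> 0" "poly m x = 0"
  obtains m' where "m' \<in> pol W" "m' \<noteq> 0" "poly m' x = 0" "min_degree W x (degree m')"
  using ex_has_least_nat[of "\<lambda>m. m \<in> pol W \<and> m \<noteq> 0 \<and> poly m x = 0" m degree] assms that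
  unfolding min_degree_def by blast

section \<open>Finiteness of simple extensions and its descent to the base field\<close>

lemma fin_over_algebraic:
  assumes W: "is_subfield W" and "m \<in> pol W" "m \<noteq> 0" "poly m x = 0"
  shows "fin_over W (adjoin W x)"
proof -
  obtain m' where m': "m' \<in> pol W" "m' \<noteq> 0" "poly m' x = 0" "min_degree W x (degree m')"
    by (rule min_poly_exists[OF assms(2-4)])
  define B where "B = (\<lambda>i. x ^ i) ` {..<degree m'}"
  have "y \<in> fspan W B" if y: "y \<in> adjoin W x" for y
  proof -
    obtain g where g: "g \<in> pol W" "degree g < degree m'" "y = poly g x"
      by (rule adjoin_algebraic[OF W m' y])
    have "x ^ i \<in> fspan W B" if "i \<le> degree g" for i
      using fspan_superset[OF W, of B] g that by (auto simp: B_def)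
    thus ?thesis using g(1) unfolding g(3) poly_altdef
      by (intro subsp_sum[OF subsp_fspan[OF W]] subsp_smult[OF subsp_fspan[OF W]]) (auto simp: pol_def)
  qed
  moreover have "B \<subseteq> adjoin W x"
    using adjoin_superset by (auto simp: B_def intro!: subfield_power[OF subfield_gen_field])
  ultimately show ?thesis unfolding fin_over_def by (intro exI[of _ B]) (auto simp: B_def)
qed

lemma fin_over_descend:
  fixes W :: "'a::field set"
  assumes p: "CHAR('a) > 0" and W: "is_subfield W" and V: "is_subfield V" and WV: "W \<subseteq> V"
    and fin: "fin_over W V" and finV: "fin_over (frob 1 V) V"
  shows "fin_over (frob 1 W) W"
proof -
  have "fin_over (frob 1 W) V"
    by (rule fin_over_trans[OF _ _ V _ _ finV fin_over_frob_frob[OF p fin]])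
      (auto simp: subfield_frob[OF p] W V frob_subset frob_mono[OF WV])
  then obtain B where B: "finite B" "B \<subseteq> V" "V \<subseteq> fspan (frob 1 W) B" by (auto simp: fin_over_def)
  \<comment> \<open>This leads to a \<open>W\<close>-linear projection of \<open>V\<close> onto
    \<open>W\<close>, which carries a finite spanning set of \<open>V\<close> over
    \<open>W_1\<close> to one of \<open>W\<close>.\<close>
  have "lin_on W W (\<lambda>x. x)" "(\<lambda>x. x) ` W \<subseteq> W" by (auto simp: lin_on_def)
  then obtain g where g: "lin_on W V g" "\<forall>x\<in>W. g x = x" "g ` V \<subseteq> W"
    by (rule lin_on_extend_fin[OF W fin subsp_self[OF W]])
  have "x \<in> V \<and> g x \<in> fspan (frob 1 W) (g ` B)" if "x \<in> fspan (frob 1 W) B" for x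
    using that
  proof (induction rule: fspan.induct)
    case zero
    thus ?case using lin_on_0[OF g(1) subfield_0[OF V]] by (simp add: subfield_0[OF V] fspan.zero)
  next
    case (step c b x)
    have c: "c \<in> W" and b: "b \<in> V" using step frob_subset[OF W] B by auto
    have cb: "c * b \<in> V" using b c WV subfield_mult[OF V] by blast
    have "g (c * b + x) = c * g b + g x" using cb b c step lin_onD[OF g(1)] by simp
    thus ?case using step cb subfield_add[OF V] by (auto intro: fspan.step)
  qed
  hence "W \<subseteq> fspan (frob 1 W) (g ` B)" using B WV g(2) by (metis subset_iff)
  moreover have "g ` B \<subseteq> W" using g B by blast
  ultimately show ?thesis using B unfolding fin_over_def by (intro exI[of _ "g ` B"]) auto
qed

text \<open>With denominators brought into \<open>W_1\<close>, finitely many numerators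
  \<open>G b\<close> account for all of \<open>V\<close>. Transcendence permits comparison of
  coefficients, so the coefficients of these numerators span \<open>W\<close> over
  \<open>W_1\<close>.\<close>

lemma transcendental_fin_over:
  fixes W :: "'a::field set"
  assumes p: "CHAR('a) > 0" and W: "is_subfield W" and tr: "\<And>g. g \<in> pol W \<Longrightarrow> poly g x = 0 \<Longrightarrow> g = 0"
    and fin: "fin_over (frob 1 (adjoin W x)) (adjoin W x)"
  shows "fin_over (frob 1 W) W"
proof -
  define V where "V = adjoin W x"
  define F where "F = frob 1 W"
  have F: "is_subfield F" unfolding F_def by (rule subfield_frob[OF p W])
  have FW: "F \<subseteq> W" unfolding F_def by (rule frob_subset[OF W])
  obtain B where B: "finite B" "B \<subseteq> V" "V \<subseteq> fspan (frob 1 V) B" using fin by (auto simp: fin_over_def V_def)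
  have "\<exists>g v. g \<in> pol W \<and> v \<in> pol F \<and> poly v x \<noteq> 0 \<and> b * poly v x = poly g x" if b: "b \<in> V" for b
  proof -
    obtain g h where gh: "g \<in> pol W" "h \<in> pol W" "poly h x \<noteq> 0" "b * poly h x = poly g x"
      using adjoin_fraction[OF W] b unfolding V_def by metis
    let ?q = "CHAR('a) ^ 1"
    \<comment> \<open>Expanding the fraction by \<open>h ^ (p - 1)\<close> turns its denominator
      into \<open>h ^ p\<close>, whose coefficients are in \<open>W_1\<close>.\<close>
    have "h ^ ?q = h * h ^ (?q - 1)" using p by (metis One_nat_def power_eq_if power_one_right not_gr0)
    hence "b * poly (h ^ ?q) x = poly (g * h ^ (?q - 1)) x" using gh by (simp flip: gh(4))
    moreover have "h ^ i \<in> pol W" for i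
      by (induction i) (auto intro: pol_field_mult[OF W] gh pol_const[OF W subfield_1[OF W], folded one_pCons])
    moreover have "h ^ ?q \<in> pol F" unfolding F_def by (rule pol_power_frob[OF p W gh(2)])
    moreover have "poly (h ^ ?q) x \<noteq> 0" using gh by simp
    ultimately show ?thesis using gh pol_field_mult[OF W] by blast
  qed
  then obtain G N where G: "\<And>b. b \<in> V \<Longrightarrow> G b \<in> pol W" "\<And>b. b \<in> V \<Longrightarrow> N b \<in> pol F"
    "\<And>b. b \<in> V \<Longrightarrow> poly (N b) x \<noteq> 0" "\<And>b. b \<in> V \<Longrightarrow> b * poly (N b) x = poly (G b) x" by metis
  define C where "C = (\<Union>b\<in>B. coeff (G b) ` {..degree (G b)})"
  have C: "finite C" "C \<subseteq> W" using B G by (auto simp: C_def pol_def)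
  note S = subsp_fspan[OF F, of C]
  have GC: "G b \<in> pol (fspan F C)" if "b \<in> B" for b unfolding pol_def
  proof safe
    fix i
    show "coeff (G b) i \<in> fspan F C"
    proof (cases "i \<le> degree (G b)")
      case True
      hence "coeff (G b) i \<in> C" using that by (auto simp: C_def)
      thus ?thesis using fspan_superset[OF F] by blast
    next
      case False thus ?thesis by (simp add: coeff_eq_0 fspan.zero)
    qed
  qed
  have key: "\<exists>v\<in>pol F. \<exists>r\<in>pol (fspan F C). poly v x \<noteq> 0 \<and> y * poly v x = poly r x"
    if "y \<in> fspan (frob 1 V) B" for y
    using that
  proof (induction rule: fspan.induct)
    case zero
    show ?case using pol_const[OF F subfield_1[OF F]] pol_0[OF fspan.zero]
      by (intro bexI[of _ "[:1:]"] bexI[of _ 0]) auto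
  next
    case (step c b y)
    obtain v r where y: "v \<in> pol F" "r \<in> pol (fspan F C)" "poly v x \<noteq> 0" "y * poly v x = poly r x"
      using step by blast
    obtain s t where c: "s \<in> pol F" "t \<in> pol F" "poly t x \<noteq> 0" "c * poly t x = poly s x"
      using frob_adjoin_fraction[OF p W] step(1) unfolding V_def F_def by metis
    have b: "b \<in> V" using step B by auto
    have "(c * b + y) * poly (t * N b * v) x = poly (s * v * G b + t * N b * r) x"
      by (simp flip: y(4) c(4) G(4)[OF b] add: algebra_simps)
    moreover have "s * v * G b + t * N b * r \<in> pol (fspan F C)"
      using y c G(2)[OF b] GC[OF step(2)] by (intro pol_add[OF S] pol_mult[OF S] pol_field_mult[OF F])
    moreover have "t * N b * v \<in> pol F" using y c G(2)[OF b] by (intro pol_field_mult[OF F])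
    moreover have "poly (t * N b * v) x \<noteq> 0" using y c G(3)[OF b] by simp
    ultimately show ?case by blast
  qed
  have CW: "fspan F C \<subseteq> W" by (rule fspan_least[OF subsp_subfield[OF W FW] C(2)])
  have "w \<in> fspan F C" if w: "w \<in> W" for w
  proof -
    have "w \<in> V" using w adjoin_superset unfolding V_def by blast
    then obtain v r where y: "v \<in> pol F" "r \<in> pol (fspan F C)" "poly v x \<noteq> 0" "w * poly v x = poly r x"
      using key B by blast
    have vW: "v \<in> pol W" and rW: "r \<in> pol W" using y pol_mono[OF FW] pol_mono[OF CW] by auto
    have "[:w:] * v + - r \<in> pol W"
      by (intro pol_field_add[OF W] pol_minus[OF W] pol_field_mult[OF W] pol_const[OF W] w vW rW)
    hence "[:w:] * v + - r = 0" by (rule tr) (simp add: y)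
    hence "smult w v = r" by simp
    \<comment> \<open>An identity of polynomials, no longer of values: the coefficient at
      \<open>degree v\<close> can be solved for \<open>w\<close>.\<close>
    hence "w * lead_coeff v = coeff r (degree v)" by auto
    moreover have "lead_coeff v \<noteq> 0" using y by auto
    ultimately have "w = inverse (lead_coeff v) * coeff r (degree v)" by (simp add: field_simps)
    thus ?thesis using y subsp_smult[OF S] subfield_inverse[OF F] by (simp add: pol_def)
  qed
  thus ?thesis unfolding fin_over_def F_def[symmetric] using C by blast
qed

section \<open>Extending linear maps along a tower\<close>

text \<open>The \<open>F\<close>-span of the graph of \<open>E\<close>, kept as a relation: linear
  disjointness enters exactly in showing that it is single-valued.\<close>

inductive_set lgraph :: "'a::field set \<Rightarrow> 'a set \<Rightarrow> ('a \<Rightarrow> 'a) \<Rightarrow> ('a \<times> 'a) set" for F W E where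
  zero: "(0, 0) \<in> lgraph F W E"
| step: "c \<in> F \<Longrightarrow> w \<in> W \<Longrightarrow> (y, z) \<in> lgraph F W E \<Longrightarrow> (c * w + y, c * E w + z) \<in> lgraph F W E"

lemma lgraph_add:
  assumes "(y, z) \<in> lgraph F W E" "(y', z') \<in> lgraph F W E"
  shows "(y + y', z + z') \<in> lgraph F W E"
  using assms(1) by (induction rule: lgraph.induct) (auto simp: add.assoc assms(2) intro: lgraph.step)

lemma lgraph_smult:
  assumes "is_subfield F" "a \<in> F" "(y, z) \<in> lgraph F W E"
  shows "(a * y, a * z) \<in> lgraph F W E"
  using assms(3) by (induction rule: lgraph.induct)
    (auto simp: distrib_left mult.assoc[symmetric] intro!: lgraph.intros subfield_mult[OF assms(1)] assms(2))

text \<open>Differences of pairs are again pairs, so a relation with only \<open>0\<close> over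
  \<open>0\<close> is a function. It is linear on its domain and extends by finite
  dimension.\<close>

lemma lgraph_extend:
  assumes F: "is_subfield F" and fin: "fin_over F V"
    and rel: "\<And>z. (0, z) \<in> lgraph F W E \<Longrightarrow> z = 0"
  obtains D where "lin_on F V D" "\<forall>x\<in>W. D x = E x"
proof -
  define S where "S = Domain (lgraph F W E)"
  define g where "g y = (THE z. (y, z) \<in> lgraph F W E)" for y
  have g: "g y = z" if yz: "(y, z) \<in> lgraph F W E" for y z
    unfolding g_def
  proof (rule the_equality, rule yz)
    fix z' assume "(y, z') \<in> lgraph F W E"
    from lgraph_add[OF this lgraph_smult[OF F subfield_minus[OF F subfield_1[OF F]] yz]]
    have "(0, z' - z) \<in> lgraph F W E" by simp
    thus "z' = z" using rel[of "z' - z"] by simp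
  qed
  have S: "subsp F S" unfolding subsp_def S_def
    by (auto simp: Domain_iff intro: lgraph.zero lgraph_add lgraph_smult[OF F])
  have "lin_on F S g" unfolding lin_on_def
  proof (intro conjI ballI)
    fix y assume "y \<in> S"
    then obtain z where z: "(y, z) \<in> lgraph F W E" by (auto simp: S_def)
    { fix c assume "c \<in> F"
      from lgraph_smult[OF F this z] show "g (c * y) = c * g y" using g z by simp }
    { fix y' assume "y' \<in> S"
      then obtain z' where z': "(y', z') \<in> lgraph F W E" by (auto simp: S_def)
      from lgraph_add[OF z z'] show "g (y + y') = g y + g y'" using g z z' by simp }
  qed
  moreover have "g ` S \<subseteq> UNIV" by simp
  ultimately obtain D where D: "lin_on F V D" "\<forall>x\<in>S. D x = g x" "D ` V \<subseteq> UNIV"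
    by (rule lin_on_extend_fin[OF F fin S])
  have "(x, E x) \<in> lgraph F W E" if "x \<in> W" for x
    using lgraph.step[OF subfield_1[OF F] that lgraph.zero] by simp
  hence "D x = E x" if "x \<in> W" for x using D(2) g that unfolding S_def by (metis DomainI)
  thus ?thesis using that D by blast
qed

text \<open>Clearing denominators with \<open>v\<close> over \<open>W_n\<close> writes a pair as the
  values at \<open>x\<close> of \<open>r\<close> and of \<open>E\<close> applied to
  \<open>r\<close>. If the first value is \<open>0\<close>, then \<open>r = 0\<close> by
  transcendence, so the second is \<open>0\<close>.\<close>

lemma transcendental_extend:
  fixes W :: "'a::field set"
  assumes p: "CHAR('a) > 0" and W: "is_subfield W" and tr: "\<And>g. g \<in> pol W \<Longrightarrow> poly g x = 0 \<Longrightarrow> g = 0"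
    and fin: "fin_over (frob n (adjoin W x)) (adjoin W x)" and E: "lin_on (frob n W) W E"
  obtains D where "lin_on (frob n (adjoin W x)) (adjoin W x) D" "\<forall>x\<in>W. D x = E x"
proof (rule lgraph_extend[OF subfield_frob[OF p subfield_gen_field] fin])
  fix z
  define F where "F = frob n W"
  have F: "is_subfield F" unfolding F_def by (rule subfield_frob[OF p W])
  have FW: "F \<subseteq> W" unfolding F_def by (rule frob_subset[OF W])
  have E: "lin_on F W E" using E by (simp add: F_def)
  have key: "\<exists>v\<in>pol F. \<exists>r\<in>pol W. poly v x \<noteq> 0 \<and> y * poly v x = poly r x \<and> z * poly v x = poly (map_poly E r) x"
    if "(y, z) \<in> lgraph (frob n (adjoin W x)) W E" for y z
    using that
  proof (induction rule: lgraph.induct)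
    case zero
    show ?case using pol_const[OF F subfield_1[OF F]] pol_0[OF subfield_0[OF W]]
      by (intro bexI[of _ "[:1:]"] bexI[of _ 0]) auto
  next
    case (step c w y z)
    obtain v r where y: "v \<in> pol F" "r \<in> pol W" "poly v x \<noteq> 0" "y * poly v x = poly r x"
        "z * poly v x = poly (map_poly E r) x"
      using step by blast
    obtain s t where c: "s \<in> pol F" "t \<in> pol F" "poly t x \<noteq> 0" "c * poly t x = poly s x"
      using frob_adjoin_fraction[OF p W step(1)] unfolding F_def by metis
    let ?r = "smult w (s * v) + t * r"
    have sv: "s * v \<in> pol F" using y c by (intro pol_field_mult[OF F])
    have "subsp F W" by (rule subsp_subfield[OF W FW])
    hence tr: "t * r \<in> pol W" using y c by (intro pol_mult)
    have wsv: "smult w (s * v) \<in> pol W"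
      using pol_field_mult[OF W pol_const[OF W step(2)], of "s * v"] sv pol_mono[OF FW] by auto
    have "map_poly E ?r = smult (E w) (s * v) + t * map_poly E r"
      using map_poly_lin_add[OF E W wsv tr] map_poly_lin_const[OF E W FW sv step(2)]
        map_poly_lin_mult[OF E W FW c(2) y(2)] by simp
    hence "(c * E w + z) * poly (t * v) x = poly (map_poly E ?r) x"
      by (simp flip: y(5) c(4) add: algebra_simps)
    moreover have "(c * w + y) * poly (t * v) x = poly ?r x"
      by (simp flip: y(4) c(4) add: algebra_simps)
    moreover have "?r \<in> pol W" by (rule pol_field_add[OF W wsv tr])
    moreover have "t * v \<in> pol F" using y c by (intro pol_field_mult[OF F])
    moreover have "poly (t * v) x \<noteq> 0" using y c by simp
    ultimately show ?case by blast
  qed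
  assume "(0, z) \<in> lgraph (frob n (adjoin W x)) W E"
  from key[OF this] obtain v r where *: "r \<in> pol W" "poly v x \<noteq> 0" "0 = poly r x" "z * poly v x = poly (map_poly E r) x"
    by auto
  have "r = 0" by (rule tr) (use * in auto)
  thus "z = 0" using * by simp
qed (use that in blast)

text \<open>Assumption \<open>sep\<close> is how separability of \<open>x\<close> over \<open>W\<close> enters.\<close>
lemma separable_extend:
  fixes W :: "'a::field set"
  assumes p: "CHAR('a) > 0" and W: "is_subfield W" and m: "m \<in> pol W" "m \<noteq> 0" "poly m x = 0"
    and sep: "\<And>j. min_degree W (x ^ (CHAR('a) ^ j)) (degree m)"
    and fin: "fin_over (frob n (adjoin W x)) (adjoin W x)" and E: "lin_on (frob n W) W E"
  obtains D where "lin_on (frob n (adjoin W x)) (adjoin W x) D" "\<forall>x\<in>W. D x = E x"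
proof (rule lgraph_extend[OF subfield_frob[OF p subfield_gen_field] fin])
  fix z
  define F where "F = frob n W"
  have F: "is_subfield F" unfolding F_def by (rule subfield_frob[OF p W])
  have FW: "F \<subseteq> W" unfolding F_def by (rule frob_subset[OF W])
  have E: "lin_on F W E" using E by (simp add: F_def)
  define \<xi> where "\<xi> = x ^ (CHAR('a) ^ n)"
  have md: "min_degree W x (degree m)" using sep[of 0] by simp
  have d0: "degree m > 0" using adjoin_algebraic[OF W m md subfield_0[OF subfield_gen_field]] by force
  \<comment> \<open>An element of \<open>V_n\<close> is the value at \<open>\<xi>\<close> of a
    twisted polynomial of degree below \<open>degree m\<close>. So \<open>r\<close> keeps a degree
    at which \<open>sep\<close> excludes nonzero polynomials with root \<open>\<xi>\<close>.\<close>
  have key: "\<exists>r\<in>pol W. degree r < degree m \<and> y = poly r \<xi> \<and> z = poly (map_poly E r) \<xi>"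
    if "(y, z) \<in> lgraph (frob n (adjoin W x)) W E" for y z
    using that
  proof (induction rule: lgraph.induct)
    case zero
    show ?case using pol_0[OF subfield_0[OF W]] d0 by (intro bexI[of _ 0]) auto
  next
    case (step c w y z)
    obtain r where r: "r \<in> pol W" "degree r < degree m" "y = poly r \<xi>" "z = poly (map_poly E r) \<xi>"
      using step by blast
    obtain a where a: "a \<in> adjoin W x" "c = a ^ (CHAR('a) ^ n)" using step(1) by (auto simp: frob_def)
    obtain g where g: "g \<in> pol W" "degree g < degree m" "a = poly g x"
      by (rule adjoin_algebraic[OF W m md a(1)])
    define u where "u = poly_frob n g"
    have u: "u \<in> pol F" "degree u < degree m" "c = poly u \<xi>"
      using pol_poly_frob[OF p g(1)] g a by (auto simp: u_def F_def degree_poly_frob \<xi>_def poly_poly_frob[OF p])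
    let ?r = "smult w u + r"
    have wu: "smult w u \<in> pol W"
      using pol_field_mult[OF W pol_const[OF W step(2)], of u] u pol_mono[OF FW] by auto
    have "map_poly E ?r = smult (E w) u + map_poly E r"
      using map_poly_lin_add[OF E W wu r(1)] map_poly_lin_const[OF E W FW u(1) step(2)] by simp
    moreover have "degree ?r < degree m"
      using u r by (intro degree_add_less) (auto intro: le_less_trans[OF degree_smult_le])
    ultimately show ?case using u r pol_field_add[OF W wu r(1)]
      by (intro bexI[of _ ?r]) (auto simp: algebra_simps)
  qed
  assume "(0, z) \<in> lgraph (frob n (adjoin W x)) W E"
  from key[OF this] obtain r where *: "r \<in> pol W" "degree r < degree m" "0 = poly r \<xi>" "z = poly (map_poly E r) \<xi>"
    by blast
  have "r = 0" using sep[of n] * unfolding min_degree_def \<xi>_def by (metis leD)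
  thus "z = 0" using * by simp
qed (use that in blast)

text \<open>Finiteness over the Frobenius image is bundled with extension because it descends
  through the same steps and each step uses it. The exponent \<open>m\<close> may exceed
  \<open>n\<close>, as inseparable steps raise it.\<close>

definition extendable :: "'a::field set \<Rightarrow> bool" where
  "extendable W \<longleftrightarrow> fin_over (frob 1 W) W \<and> (\<forall>n E. lin_on (frob n W) W E \<longrightarrow>
     (\<exists>m D. lin_on (frob m UNIV) UNIV D \<and> (\<forall>x\<in>W. D x = E x)))"

lemma extendable_step:
  assumes V: "extendable V" and WV: "W \<subseteq> V" and fin: "fin_over (frob 1 W) W"
    and ext: "\<And>n E. lin_on (frob n W) W E \<Longrightarrow> \<exists>m D. lin_on (frob m V) V D \<and> (\<forall>x\<in>W. D x = E x)"
  shows "extendable W"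
  unfolding extendable_def
proof (intro conjI allI impI fin)
  fix n E assume "lin_on (frob n W) W E"
  then obtain m D where D: "lin_on (frob m V) V D" "\<forall>x\<in>W. D x = E x" using ext by blast
  then obtain l D' where "lin_on (frob l UNIV) UNIV D'" "\<forall>x\<in>V. D' x = D x"
    using V unfolding extendable_def by blast
  thus "\<exists>m D. lin_on (frob m UNIV) UNIV D \<and> (\<forall>x\<in>W. D x = E x)" using D WV by (metis subsetD)
qed

section \<open>Extendability for each type of simple extension, then for all generators\<close>

lemma extendable_inseparable:
  fixes W :: "'a::field set"
  assumes p: "CHAR('a) > 0" and W: "is_subfield W" and x: "x ^ CHAR('a) \<in> W" and V: "extendable (adjoin W x)"
  shows "extendable W"
proof (rule extendable_step[OF V adjoin_superset(1)])
  define m where "m = monom 1 CHAR('a) + - [:x ^ CHAR('a):]"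
  have "coeff m CHAR('a) = 1" using p by (simp add: m_def coeff_pCons split: nat.splits)
  hence "m \<noteq> 0" by (metis coeff_0 zero_neq_one)
  hence m: "m \<in> pol W" "m \<noteq> 0" "poly m x = 0"
    using x unfolding m_def by (auto simp: poly_monom intro!: pol_field_add[OF W] pol_minus[OF W, of "[:_:]", simplified]
      pol_monom[OF W] pol_const[OF W] subfield_1[OF W] subfield_minus[OF W])
  have finV: "fin_over (frob 1 (adjoin W x)) (adjoin W x)" using V by (simp add: extendable_def)
  show "fin_over (frob 1 W) W"
    by (rule fin_over_descend[OF p W subfield_gen_field adjoin_superset(1) fin_over_algebraic[OF W m] finV])
  fix n E assume E: "lin_on (frob n W) W E"
  \<comment> \<open>The preimage of \<open>W\<close> under Frobenius is a field containing
    \<open>W\<close> and \<open>x\<close>, so \<open>V_1 \<subseteq> W\<close>. Hence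
    \<open>E\<close> is linear over \<open>V_(n+1)\<close> on \<open>W\<close>, and finite dimension
    does the rest.\<close>
  have "is_subfield {u :: 'a. u ^ CHAR('a) \<in> W}"
    using W p frob_add[OF p, of _ _ 1] frob_minus[OF p, of _ 1] unfolding is_subfield_def
    by (auto simp: power_mult_distrib power_inverse power_0_left)
  hence "adjoin W x \<subseteq> {u. u ^ CHAR('a) \<in> W}"
    using x subfield_power[OF W] by (intro gen_field_least) auto
  hence "frob 1 (adjoin W x) \<subseteq> W" by (auto simp: frob_def)
  hence sub: "frob (Suc n) (adjoin W x) \<subseteq> frob n W"
    using frob_mono[of "frob 1 (adjoin W x)" W n] by (simp add: frob_frob)
  let ?F = "frob (Suc n) (adjoin W x)"
  have "subsp ?F W" using sub frob_subset[OF W] by (intro subsp_subfield[OF W]) blast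
  moreover have "lin_on ?F W E" by (rule lin_on_subset[OF E sub order.refl])
  moreover have "E ` W \<subseteq> UNIV" by simp
  ultimately obtain D where "lin_on ?F (adjoin W x) D" "\<forall>x\<in>W. D x = E x" "D ` adjoin W x \<subseteq> UNIV"
    by (rule lin_on_extend_fin[OF subfield_frob[OF p subfield_gen_field]
      fin_over_frob[OF p subfield_gen_field finV]])
  thus "\<exists>m D. lin_on (frob m (adjoin W x)) (adjoin W x) D \<and> (\<forall>x\<in>W. D x = E x)" by blast
qed

text \<open>Replacing \<open>x\<close> by its \<open>p\<close>-th power is an inseparable step, so
  extendability passes to every \<open>W(\<xi> j)\<close>. At an index where the degree over
  \<open>W\<close> is least, the remaining extension is separable.\<close>

lemma extendable_algebraic:
  fixes W :: "'a::field set"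
  assumes p: "CHAR('a) > 0" and W: "is_subfield W" and m: "m \<in> pol W" "m \<noteq> 0" "poly m x = 0"
    and V: "extendable (adjoin W x)"
  shows "extendable W"
proof -
  define \<xi> where "\<xi> j = x ^ (CHAR('a) ^ j)" for j
  have V': "extendable (adjoin W (\<xi> j))" for j
  proof (induction j)
    case 0 thus ?case using V by (simp add: \<xi>_def)
  next
    case (Suc j)
    let ?U = "adjoin W (\<xi> (Suc j))"
    have pw: "\<xi> j ^ CHAR('a) = \<xi> (Suc j)" by (simp add: \<xi>_def mult.commute flip: power_mult)
    hence "\<xi> j ^ CHAR('a) \<in> ?U" using adjoin_superset(2)[of "\<xi> (Suc j)" W] by simp
    moreover have "adjoin ?U (\<xi> j) = adjoin W (\<xi> j)"
    proof
      have "\<xi> (Suc j) \<in> adjoin W (\<xi> j)" unfolding pw[symmetric]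
        by (rule subfield_power[OF subfield_gen_field adjoin_superset(2)])
      hence "?U \<subseteq> adjoin W (\<xi> j)"
        using adjoin_superset by (intro gen_field_least subfield_gen_field) auto
      thus "adjoin ?U (\<xi> j) \<subseteq> adjoin W (\<xi> j)"
        using adjoin_superset by (intro gen_field_least subfield_gen_field) auto
      show "adjoin W (\<xi> j) \<subseteq> adjoin ?U (\<xi> j)"
        using adjoin_superset(1)[where W = W and x = "\<xi> (Suc j)"] adjoin_superset[where W = ?U and x = "\<xi> j"]
        by (intro gen_field_least subfield_gen_field) auto
    qed
    ultimately show ?case using extendable_inseparable[OF p subfield_gen_field] Suc by metis
  qed
  \<comment> \<open>Minimizing over exponents and polynomials together makes \<open>degree g\<close>
    a lower bound at every Frobenius power of \<open>\<xi> e\<close>, which is the separability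
    condition.\<close>
  let ?P = "\<lambda>(j, g). g \<in> pol W \<and> g \<noteq> 0 \<and> poly g (\<xi> j) = 0"
  have "?P (0, m)" using m by (simp add: \<xi>_def)
  from ex_has_least_nat[of ?P _ "\<lambda>(j, g). degree g", OF this]
  obtain e g where g: "g \<in> pol W" "g \<noteq> 0" "poly g (\<xi> e) = 0"
    and min: "\<And>j h. h \<in> pol W \<Longrightarrow> h \<noteq> 0 \<Longrightarrow> poly h (\<xi> j) = 0 \<Longrightarrow> degree g \<le> degree h" by fastforce
  have \<xi>\<xi>: "\<xi> e ^ (CHAR('a) ^ j) = \<xi> (e + j)" for j by (simp add: \<xi>_def power_add power_mult)
  have sep: "min_degree W (\<xi> e ^ (CHAR('a) ^ j)) (degree g)" for j
    unfolding min_degree_def \<xi>\<xi> using min by blast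
  have finV: "fin_over (frob 1 (adjoin W (\<xi> e))) (adjoin W (\<xi> e))"
    using V'[of e] by (simp add: extendable_def)
  show ?thesis
  proof (rule extendable_step[OF V' adjoin_superset(1)])
    show "fin_over (frob 1 W) W"
      by (rule fin_over_descend[OF p W subfield_gen_field adjoin_superset(1) fin_over_algebraic[OF W g] finV])
    show "\<exists>m D. lin_on (frob m (adjoin W (\<xi> e))) (adjoin W (\<xi> e)) D \<and> (\<forall>x\<in>W. D x = E x)"
      if "lin_on (frob n W) W E" for n E
      using separable_extend[OF p W g sep fin_over_frob[OF p subfield_gen_field finV] that] by blast
  qed
qed

lemma extendable_simple:
  fixes W :: "'a::field set"
  assumes p: "CHAR('a) > 0" and W: "is_subfield W" and V: "extendable (adjoin W x)"
  shows "extendable W"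
proof (cases "\<exists>m\<in>pol W. m \<noteq> 0 \<and> poly m x = 0")
  case True
  thus ?thesis using extendable_algebraic[OF p W _ _ _ V] by blast
next
  case False
  hence tr: "g = 0" if "g \<in> pol W" "poly g x = 0" for g using that by blast
  have finV: "fin_over (frob 1 (adjoin W x)) (adjoin W x)"
    using V by (simp add: extendable_def)
  show ?thesis
  proof (rule extendable_step[OF V adjoin_superset(1)])
    show "fin_over (frob 1 W) W" by (rule transcendental_fin_over[OF p W tr finV])
    show "\<exists>m D. lin_on (frob m (adjoin W x)) (adjoin W x) D \<and> (\<forall>x\<in>W. D x = E x)"
      if "lin_on (frob n W) W E" for n E
      using transcendental_extend[OF p W tr fin_over_frob[OF p subfield_gen_field finV] that] by blast
  qed
qed

text \<open>The induction ends at \<open>K\<close> itself, where \<open>E\<close> is its own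
  extension. Each generator is adjoined to \<open>W\<close> before the induction hypothesis is used,
  so \<open>W\<close> varies.\<close>

lemma extendable_fin_gen:
  fixes W :: "'a::field set"
  assumes p: "CHAR('a) > 0" and fin: "fin_over (frob 1 UNIV) (UNIV :: 'a set)" and S: "finite S"
    and W: "is_subfield W" and gen: "gen_field (W \<union> S) = UNIV"
  shows "extendable W"
  using S W gen
proof (induction S arbitrary: W rule: finite_induct)
  case empty
  hence "W = UNIV" using gen_field_least[of W W] by auto
  thus ?case using fin unfolding extendable_def by auto
next
  case (insert x S)
  have "gen_field (W \<union> insert x S) \<subseteq> gen_field (adjoin W x \<union> S)"
    using adjoin_superset[where W = W and x = x] gen_field_superset[of "adjoin W x \<union> S"]
    by (intro gen_field_least subfield_gen_field) auto
  hence "extendable (adjoin W x)" using insert by (intro insert.IH subfield_gen_field) auto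
  thus ?case by (rule extendable_simple[OF p insert.prems(1)])
qed

section \<open>The exact sequence\<close>

lemma Diff_lincomb:
  fixes n :: nat
  assumes p: "CHAR('a::field) > 0" and W: "is_subfield (W :: 'a set)" and E: "\<And>i. i < n \<Longrightarrow> is_Diff k W (E i)"
  obtains m where "lin_on (frob m W) W (\<lambda>x. \<Sum>i<n. a i * E i x)"
proof -
  have "\<exists>m. lin_on (frob m W) W (E i)" if "i < n" for i
    using Diff_imp_frob_linear[OF p W E[OF that]] by blast
  then obtain m where m: "\<And>i. i < n \<Longrightarrow> lin_on (frob (m i) W) W (E i)" by metis
  \<comment> \<open>Frobenius images shrink as the exponent grows, so an upper bound of all
    \<open>m i\<close>, here their sum, serves for every \<open>E i\<close>.\<close>
  define M where "M = (\<Sum>i<n. m i)"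
  have "lin_on (frob M W) W (E i)" if "i < n" for i
  proof -
    have "m i \<le> M" unfolding M_def by (rule member_le_sum) (use that in auto)
    thus ?thesis using lin_on_subset[OF m[OF that] frob_antimono[OF W]] by blast
  qed
  hence "lin_on (frob M W) W (\<lambda>x. \<Sum>i<n. a i * E i x)"
    by (auto simp: lin_on_def distrib_left sum.distrib sum_distrib_left mult.left_commute intro!: sum.cong)
  thus ?thesis by (rule that)
qed

context
  fixes W k :: "'K::field set"
  assumes p: "CHAR('K) > 0" and k: "k = perfect_core CHAR('K)" and fg: "fin_gen_over k"
    and W: "is_subfield W" and kW: "k \<subseteq> W"
begin

lemma k_frob: "k \<subseteq> V \<Longrightarrow> k \<subseteq> frob n V"
  unfolding k by (rule perfect_core_subset_frob[OF p])

lemma fin_over_frob_UNIV: "fin_over (frob n UNIV) (UNIV :: 'K set)"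
  using fin_over_frob[OF p subfield_UNIV fin_gen_imp_fin_over_frob[OF p]] fg k by simp

lemma frob_linear_imp_Diff:
  "lin_on (frob n UNIV) UNIV D \<Longrightarrow> is_Diff k UNIV D"
  by (rule linear_imp_Diff[OF p subfield_frob[OF p subfield_UNIV] subfield_UNIV _ order.refl fin_over_frob_UNIV k_frob])
    auto

lemma extendable_W: "extendable W"
proof -
  obtain S where S: "finite S" "gen_field (k \<union> S) = UNIV" using fg by (auto simp: fin_gen_over_def)
  have "gen_field (k \<union> S) \<subseteq> gen_field (W \<union> S)"
    using kW gen_field_superset[of "W \<union> S"] by (intro gen_field_least subfield_gen_field) auto
  hence "gen_field (W \<union> S) = UNIV" using S by auto
  thus ?thesis using extendable_fin_gen[OF p _ S(1) W] fin_over_frob_UNIV by blast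
qed

text \<open>The restriction is linear over \<open>W_m\<close>, over which \<open>W\<close> is
  finite, so it decomposes into \<open>W_m\<close>-valued functionals; these are operators on
  \<open>W\<close>.\<close>

lemma restriction_in_span:
  assumes D: "is_Diff k UNIV D"
  shows "\<exists>(n::nat) a E. (\<forall>i<n. is_Diff k W (E i)) \<and> (\<forall>x\<in>W. D x = (\<Sum>i<n. a i * E i x))"
proof -
  obtain m where "lin_on (frob m UNIV) UNIV D" by (rule Diff_imp_frob_linear[OF p subfield_UNIV D])
  hence lin: "lin_on (frob m W) W D" by (rule lin_on_subset) (use frob_mono[of W UNIV m] in auto)
  have fin: "fin_over (frob m W) W"
    using extendable_W fin_over_frob[OF p W] by (simp add: extendable_def)
  obtain n :: nat and a E where
    E: "\<forall>i<n. lin_on (frob m W) W (E i) \<and> E i ` W \<subseteq> frob m W"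
    "\<forall>x\<in>W. D x = (\<Sum>i<n. a i * E i x)"
    by (rule lin_on_decomp[OF subfield_frob[OF p W] W frob_subset[OF W] fin lin])
  have "is_Diff k W (E i)" if "i < n" for i
    using E(1) that frob_subset[OF W]
    by (intro linear_imp_Diff[OF p subfield_frob[OF p W] W frob_subset[OF W] order.refl fin k_frob[OF kW]]) auto
  thus ?thesis using E(2) by blast
qed

lemma span_extends:
  fixes n :: nat
  assumes "\<forall>i<n. is_Diff k W (E i)"
  shows "\<exists>D. is_Diff k UNIV D \<and> (\<forall>x\<in>W. D x = (\<Sum>i<n. a i * E i x))"
proof -
  obtain m where "lin_on (frob m W) W (\<lambda>x. \<Sum>i<n. a i * E i x)"
    using Diff_lincomb[OF p W, of n k E a] assms by blast
  then obtain l D where "lin_on (frob l UNIV) UNIV D" "\<forall>x\<in>W. D x = (\<Sum>i<n. a i * E i x)"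
    using extendable_W unfolding extendable_def by blast
  thus ?thesis using frob_linear_imp_Diff by blast
qed

text \<open>Gives more than membership in the span, namely a single composite: \<open>P\<close> is
  the complement of a projection onto the field generated by \<open>K_m\<close> and
  \<open>W\<close>, on which \<open>D\<close> vanishes.\<close>

lemma kernel_factors:
  assumes D: "is_Diff k UNIV D" and DW: "\<forall>x\<in>W. D x = 0"
  shows "\<exists>P. is_E W P \<and> D = (\<lambda>x. D (P x))"
proof -
  obtain m where m: "lin_on (frob m UNIV) UNIV D" by (rule Diff_imp_frob_linear[OF p subfield_UNIV D])
  \<comment> \<open>The compositum of \<open>K_m\<close> and \<open>W\<close>, taken as a span: a
    ring because \<open>W\<close> is closed under products, a field because \<open>p ^ m\<close>-th
    powers land in \<open>K_m\<close>.\<close>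
  define F where "F = fspan (frob m UNIV) W"
  note Fm = subfield_frob[OF p subfield_UNIV, of m]
  have spF: "subsp (frob m UNIV) F" unfolding F_def by (rule subsp_fspan[OF Fm])
  have WF: "W \<subseteq> F" unfolding F_def by (rule fspan_superset[OF Fm])
  have mF: "x * y \<in> F" if "x \<in> F" "y \<in> F" for x y
  proof -
    have *: "w * y \<in> F" if w: "w \<in> W" for w
      using \<open>y \<in> F\<close> unfolding F_def
    proof (induction rule: fspan.induct)
      case (step c b y)
      have "w * (c * b + y) = c * (w * b) + w * y" by (simp add: algebra_simps)
      thus ?case using step w subfield_mult[OF W] by (auto intro: fspan.step)
    qed (simp add: fspan.zero)
    show ?thesis using \<open>x \<in> F\<close> unfolding F_def
    proof (induction rule: fspan.induct)
      case (step c b x)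
      have "(c * b + x) * y = c * (b * y) + x * y" by (simp add: algebra_simps)
      thus ?case using step * subsp_smult[OF spF] by (auto simp: F_def intro: fspan_add)
    qed (simp add: fspan.zero)
  qed
  have FmF: "frob m UNIV \<subseteq> F"
  proof
    fix c :: 'K assume "c \<in> frob m UNIV"
    thus "c \<in> F" using subsp_smult[OF spF, of c 1] WF subfield_1[OF W] by auto
  qed
  have F: "is_subfield F"
    by (rule subfield_if_power_closed[OF Fm FmF spF mF, of "CHAR('K) ^ m"]) (use p frobI in auto)
  have DF: "D x = 0" if "x \<in> F" for x
    using that unfolding F_def
  proof (induction rule: fspan.induct)
    case zero thus ?case using lin_on_0[OF m] by simp
  next
    case (step c b x) thus ?case using m DW by (simp add: lin_on_def)
  qed
  obtain B where B: "finite B" "UNIV \<subseteq> fspan (frob m UNIV) (B :: 'K set)"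
    using fin_over_frob_UNIV unfolding fin_over_def by blast
  have "fspan (frob m UNIV) B \<subseteq> fspan F B"
    using FmF fspan_superset[OF F] by (intro fspan_least subsp_subset[OF subsp_fspan[OF F]]) auto
  hence fin: "fin_over F UNIV" using B unfolding fin_over_def by blast
  have "lin_on F F (\<lambda>x. x)" "(\<lambda>x. x) ` F \<subseteq> F" by (auto simp: lin_on_def)
  then obtain g where g: "lin_on F UNIV g" "\<forall>x\<in>F. g x = x" "g ` UNIV \<subseteq> F"
    by (rule lin_on_extend_fin[OF F fin subsp_self[OF F]])
  \<comment> \<open>Linearity over \<open>F\<close> makes \<open>P\<close> a differential operator
    over \<open>W\<close>, and \<open>P 1 = 0\<close> because \<open>g\<close> fixes
    \<open>F\<close>.\<close>
  define P where "P x = x - g x" for x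
  have "lin_on F UNIV P" using g(1) by (simp add: lin_on_def P_def algebra_simps)
  hence "is_Diff W UNIV P"
    by (intro linear_imp_Diff[OF p F subfield_UNIV _ FmF fin WF]) auto
  moreover have "P 1 = 0" using g(2) subfield_1[OF F] by (simp add: P_def)
  moreover have "D x = D (P x)" for x
  proof -
    have "D (P x + g x) = D (P x) + D (g x)" using m unfolding lin_on_def by blast
    moreover have "D (g x) = 0" using DF g(3) by blast
    ultimately show ?thesis by (simp add: P_def)
  qed
  ultimately show ?thesis unfolding is_E_def by blast
qed

lemma composites_in_kernel:
  fixes n :: nat
  assumes D: "\<forall>i<n. is_Diff k UNIV (D1 i) \<and> is_E W (D2 i)"
  shows "is_Diff k UNIV (\<lambda>x. \<Sum>i<n. a i * D1 i (D2 i x))" "\<forall>x\<in>W. (\<Sum>i<n. a i * D1 i (D2 i x)) = 0"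
proof -
  have comp: "is_Diff k UNIV (\<lambda>x. D1 i (D2 i x))" if i: "i < n" for i
  proof -
    obtain m where m: "lin_on (frob m UNIV) UNIV (D1 i)"
      using Diff_imp_frob_linear[OF p subfield_UNIV, of k "D1 i"] D i by blast
    obtain l where l: "lin_on (frob l UNIV) UNIV (D2 i)"
      using Diff_imp_frob_linear[OF p subfield_UNIV, of W "D2 i"] D i unfolding is_E_def by blast
    have "lin_on (frob (m + l) UNIV) UNIV (D1 i)" "lin_on (frob (m + l) UNIV) UNIV (D2 i)"
      by (rule lin_on_subset[OF m frob_antimono[OF subfield_UNIV]] lin_on_subset[OF l frob_antimono[OF subfield_UNIV]]; simp)+
    hence "lin_on (frob (m + l) UNIV) UNIV (\<lambda>x. D1 i (D2 i x))" by (simp add: lin_on_def)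
    thus ?thesis by (rule frob_linear_imp_Diff)
  qed
  obtain m where "lin_on (frob m UNIV) UNIV (\<lambda>x. \<Sum>i<n. a i * D1 i (D2 i x))"
    using Diff_lincomb[OF p subfield_UNIV, of n k "\<lambda>i x. D1 i (D2 i x)" a] comp by blast
  thus "is_Diff k UNIV (\<lambda>x. \<Sum>i<n. a i * D1 i (D2 i x))" by (rule frob_linear_imp_Diff)
  \<comment> \<open>Linearity over \<open>W\<close> gives \<open>D2 i x = x * D2 i 1 = 0\<close> for
    \<open>x \<in> W\<close>, and \<open>D1 i\<close> sends \<open>0\<close> to
    \<open>0\<close>.\<close>
  have "D1 i (D2 i x) = 0" if i: "i < n" and x: "x \<in> W" for i x
  proof -
    obtain l where "diff_filt W UNIV l (D2 i)" using D i by (auto simp: is_E_def is_Diff_def)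
    hence "D2 i (x * 1) = x * D2 i 1" using x
      by (cases l) (simp, simp only: diff_filt_ad is_End_def UNIV_I ball_simps simp_thms)
    hence "D2 i x = 0" using D i by (simp add: is_E_def)
    moreover obtain m where "lin_on (frob m UNIV) UNIV (D1 i)"
      using Diff_imp_frob_linear[OF p subfield_UNIV, of k "D1 i"] D i by blast
    ultimately show ?thesis using lin_on_0 by force
  qed
  thus "\<forall>x\<in>W. (\<Sum>i<n. a i * D1 i (D2 i x)) = 0" by simp
qed

end

theorem mainTheorem4:
  fixes W :: "'K::field set"
  defines "k \<equiv> perfect_core CHAR('K) :: 'K set"
  assumes char_pos: "CHAR('K) > 0"
    and fg: "fin_gen_over k"
    and W_sub: "is_subfield W"
    and kW: "k \<subseteq> W"
  shows
    \<comment> \<open>injectivity of Diff_k(W) \<otimes>_W K \<rightarrow> Hom_k(W,K): W-linearly independent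
        operators stay K-linearly independent as maps W \<rightarrow> K\<close>
    "(\<forall>(n::nat) (E :: nat \<Rightarrow> 'K \<Rightarrow> 'K).
        (\<forall>i<n. is_Diff k W (E i)) \<longrightarrow>
        (\<forall>w. (\<forall>i<n. w i \<in> W) \<longrightarrow> (\<forall>x\<in>W. (\<Sum>i<n. w i * E i x) = 0) \<longrightarrow> (\<forall>i<n. w i = 0)) \<longrightarrow>
        (\<forall>a. (\<forall>x\<in>W. (\<Sum>i<n. a i * E i x) = 0) \<longrightarrow> (\<forall>i<n. a i = 0)))
     \<and>
     \<comment> \<open>(a): image of d(K/W) = image of Diff_k(W) \<otimes>_W K in Hom_k(W,K)\<close>
     (\<forall>D. is_Diff k UNIV D \<longrightarrow>
        (\<exists>(n::nat) (a :: nat \<Rightarrow> 'K) (E :: nat \<Rightarrow> 'K \<Rightarrow> 'K).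
            (\<forall>i<n. is_Diff k W (E i)) \<and> (\<forall>x\<in>W. D x = (\<Sum>i<n. a i * E i x))))
     \<and>
     (\<forall>(n::nat) (a :: nat \<Rightarrow> 'K) (E :: nat \<Rightarrow> 'K \<Rightarrow> 'K).
        (\<forall>i<n. is_Diff k W (E i)) \<longrightarrow>
        (\<exists>D. is_Diff k UNIV D \<and> (\<forall>x\<in>W. D x = (\<Sum>i<n. a i * E i x))))
     \<and>
     \<comment> \<open>(b): kernel of d(K/W) = K-span of Diff_k(K) \<circ> \<frak>E(K/W)\<close>
     {D. is_Diff k UNIV D \<and> (\<forall>x\<in>W. D x = 0)} =
     {D. \<exists>(n::nat) (a :: nat \<Rightarrow> 'K) (D1 :: nat \<Rightarrow> 'K \<Rightarrow> 'K) (D2 :: nat \<Rightarrow> 'K \<Rightarrow> 'K).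
           (\<forall>i<n. is_Diff k UNIV (D1 i) \<and> is_E W (D2 i)) \<and>
           D = (\<lambda>x. \<Sum>i<n. a i * D1 i (D2 i x))}"
proof (intro conjI allI impI)
  note c = char_pos meta_eq_to_obj_eq[OF k_def] fg W_sub kW
  { fix n :: nat and E :: "nat \<Rightarrow> 'K \<Rightarrow> 'K" and a and i
    assume E: "\<forall>i<n. is_Diff k W (E i)"
      and ind: "\<forall>w. (\<forall>i<n. w i \<in> W) \<longrightarrow> (\<forall>x\<in>W. (\<Sum>i<n. w i * E i x) = 0) \<longrightarrow> (\<forall>i<n. w i = 0)"
      and a: "\<forall>x\<in>W. (\<Sum>i<n. a i * E i x) = 0" and i: "i < n"
    \<comment> \<open>Filtration index \<open>0\<close> means that \<open>E i\<close> is zero on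
      \<open>W\<close>; any larger index includes being an endomorphism of \<open>W\<close>.\<close>
    have "E i x \<in> W" if "i < n" "x \<in> W" for i x
    proof -
      obtain l where "diff_filt k W l (E i)" using E \<open>i < n\<close> by (auto simp: is_Diff_def)
      thus ?thesis using that subfield_0[OF W_sub] by (cases l) (auto simp: diff_filt_ad is_End_def)
    qed
    thus "a i = 0" using ind a i by (intro sum_independent_extend[OF W_sub, of n E a i]) auto }
  { fix D assume "is_Diff k UNIV D"
    thus "\<exists>(n::nat) a E. (\<forall>i<n. is_Diff k W (E i)) \<and> (\<forall>x\<in>W. D x = (\<Sum>i<n. a i * E i x))"
      by (rule restriction_in_span[OF c]) }
  { fix n :: nat and a :: "nat \<Rightarrow> 'K" and E :: "nat \<Rightarrow> 'K \<Rightarrow> 'K" assume "\<forall>i<n. is_Diff k W (E i)"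
    thus "\<exists>D. is_Diff k UNIV D \<and> (\<forall>x\<in>W. D x = (\<Sum>i<n. a i * E i x))"
      by (rule span_extends[OF c]) }
  show "{D. is_Diff k UNIV D \<and> (\<forall>x\<in>W. D x = 0)} =
     {D. \<exists>(n::nat) (a :: nat \<Rightarrow> 'K) (D1 :: nat \<Rightarrow> 'K \<Rightarrow> 'K) (D2 :: nat \<Rightarrow> 'K \<Rightarrow> 'K).
           (\<forall>i<n. is_Diff k UNIV (D1 i) \<and> is_E W (D2 i)) \<and>
           D = (\<lambda>x. \<Sum>i<n. a i * D1 i (D2 i x))}" (is "?L = ?R")
  proof (intro equalityI subsetI)
    fix D assume "D \<in> ?L"
    hence D: "is_Diff k UNIV D" "\<forall>x\<in>W. D x = 0" by auto
    obtain P where P: "is_E W P" "D = (\<lambda>x. D (P x))" using kernel_factors[OF c D] by blast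
    have "(\<forall>i<1. is_Diff k UNIV D \<and> is_E W P) \<and> D = (\<lambda>x. \<Sum>i<1::nat. 1 * D (P x))"
      using D(1) P by simp
    thus "D \<in> ?R" unfolding mem_Collect_eq
      by (intro exI[of _ "1::nat"] exI[of _ "\<lambda>_. 1"] exI[of _ "\<lambda>_. D"] exI[of _ "\<lambda>_. P"])
  next
    fix D assume "D \<in> ?R"
    then obtain n :: nat and a D1 D2 where *: "\<forall>i<n. is_Diff k UNIV (D1 i) \<and> is_E W (D2 i)"
      "D = (\<lambda>x. \<Sum>i<n. a i * D1 i (D2 i x))" unfolding mem_Collect_eq by blast
    show "D \<in> ?L" unfolding mem_Collect_eq *(2) using composites_in_kernel[OF c *(1)] by blast
  qed
qed

end
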